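(* Let $(M,F)$ be a Finsler manifold. The following properties are equivalent: (a) (Heine-Borel property) the symmetrized closed balls $\bar B_s(x,r)$ are compact for all $x\in M$ and $r>0$; (b) $\bar B^+(x,r)\cap\bar B^-(x,r)$ is compact for any $x\in M$ and $r>0$; (c) $\bar B^+(x,r_1)\cap\bar B^-(y,r_2)$ is compact for any $x,y\in M$ and $r_1,r_2>0$. Moreover, if any of the conditions (a), (b), (c) holds, then the metric space $(M,d_s)$ is complete.
   Context: A Finsler manifold $(M,F)$ is a $C^\infty$, paracompact, connected finite-dimensional manifold $M$ with a continuous function $F:TM\to[0,+\infty)$ that is $C^\infty$ away from the zero section, fiberwise positively homogeneous of degree one ($F(\lambda v)=\lambda F(v)$ for $\lambda>0$), and such that the fiberwise Hessian of $\frac12F^2$ is positive definite at each nonzero vector ($F$ need not be reversible). $d(p,q)$ is the infimum of $\int_a^bF(\dot\gamma(s))\,ds$ over piecewise smooth curves $\gamma$ from $p$ to $q$ (in general non-symmetric). $B^+(p,r)=\{x:d(p,x)<r\}$, $B^-(p,r)=\{x:d(x,p)<r\}$. The symmetrized distance is $d_s(p,q)=\frac12(d(p,q)+d(q,p))$, with open balls $B_s(x,r)$. A bar denotes closure, as in $\bar B^+(p,r)$, $\bar B^-(p,r)$, $\bar B_s(p,r)$. *)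

theory Defs
  imports "HOL-Analysis.Analysis"
begin

section \<open>Smooth maps between normed spaces\<close>

text \<open>
  \<open>Ck_on k S f\<close> is only meant for open \<open>S\<close> in a finite-dimensional space, where continuity
  of all directional derivatives of order \<open>k\<close> is the usual \<open>C\<^sup>k\<close> condition.
\<close>

primrec Ck_on :: "nat \<Rightarrow> 'e::real_normed_vector set \<Rightarrow> ('e \<Rightarrow> 'f::real_normed_vector) \<Rightarrow> bool" where
  "Ck_on 0 S f \<longleftrightarrow> continuous_on S f"
| "Ck_on (Suc k) S f \<longleftrightarrow> (\<forall>x\<in>S. f differentiable (at x)) \<and>
     (\<forall>h. Ck_on k S (\<lambda>x. frechet_derivative f (at x) h))"

text \<open>
  \<open>C\<^sup>\<infinity>\<close> on an arbitrary set: locally the restriction of a \<open>C\<^sup>\<infinity>\<close> map defined on an open set.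
  For open \<open>S\<close> this is ordinary smoothness; for a compact interval it is smoothness up to
  the end points.
\<close>

definition smooth_on :: "'e::real_normed_vector set \<Rightarrow> ('e \<Rightarrow> 'f::real_normed_vector) \<Rightarrow> bool" where
  "smooth_on S f \<longleftrightarrow>
     (\<forall>x\<in>S. \<exists>T g. open T \<and> x \<in> T \<and> (\<forall>y\<in>S \<inter> T. f y = g y) \<and> (\<forall>k. Ck_on k T g))"


section \<open>Smooth manifolds\<close>

definition paracompact_space :: "'a topology \<Rightarrow> bool" where
  "paracompact_space X \<longleftrightarrow>
     (\<forall>\<U>. (\<forall>U\<in>\<U>. openin X U) \<and> \<Union>\<U> = topspace X \<longrightarrow>
       (\<exists>\<V>. (\<forall>V\<in>\<V>. openin X V) \<and> \<Union>\<V> = topspace X \<and> (\<forall>V\<in>\<V>. \<exists>U\<in>\<U>. V \<subseteq> U) \<and>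
            locally_finite_in X \<V>))"

text \<open>A chart is a domain together with a coordinate map, whose values off the domain are junk.\<close>

type_synonym ('a, 'e) chart = "'a set \<times> ('a \<Rightarrow> 'e)"

definition chart_inv :: "('a, 'e) chart \<Rightarrow> 'e \<Rightarrow> 'a" where
  "chart_inv c = the_inv_into (fst c) (snd c)"

text \<open>
  The underlying manifold is the whole type \<open>'a\<close>; its smooth structure is the one generated by
  the (not necessarily maximal) atlas \<open>A\<close>.  The model space \<open>'e\<close> is an arbitrary
  finite-dimensional normed space.  Such a space always has the Heine-Borel property, so the
  sort constraint loses nothing; \<open>euclidean_space\<close> would exclude dimension \<open>0\<close>.
\<close>

locale smooth_manifold =
  fixes A :: "('a::t2_space, 'e::{real_normed_vector, heine_borel}) chart set"
  assumes finite_dimensional: "\<exists>B::'e set. finite B \<and> span B = UNIV"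
    and paracompact: "paracompact_space (euclidean :: 'a topology)"
    and connected: "connected (UNIV :: 'a set)"
    and chart: "\<And>c. c \<in> A \<Longrightarrow> open (fst c) \<and> open (snd c ` fst c) \<and>
                  homeomorphism (fst c) (snd c ` fst c) (snd c) (chart_inv c)"
    and cover: "(\<Union>c\<in>A. fst c) = UNIV"
    and compatible: "\<And>c c'. c \<in> A \<Longrightarrow> c' \<in> A \<Longrightarrow>
                  smooth_on (snd c ` (fst c \<inter> fst c')) (snd c' \<circ> chart_inv c)"


section \<open>The tangent bundle\<close>

text \<open>
  A tangent vector at \<open>p\<close> is the family of its coordinate vectors in all charts around \<open>p\<close>,
  related by the derivatives of the coordinate changes.  The value \<open>0\<close> at all other arguments
  makes the family unique.  The vector space operations are pointwise.
\<close>

type_synonym ('a, 'e) tangent = "('a, 'e) chart \<Rightarrow> 'e"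

definition tangent_space ::
    "('a, 'e::real_normed_vector) chart set \<Rightarrow> 'a \<Rightarrow> ('a, 'e) tangent set" where
  "tangent_space A p =
     {v. (\<forall>c. \<not> (c \<in> A \<and> p \<in> fst c) \<longrightarrow> v c = 0) \<and>
         (\<forall>c\<in>A. \<forall>c'\<in>A. p \<in> fst c \<inter> fst c' \<longrightarrow>
            v c' = frechet_derivative (snd c' \<circ> chart_inv c) (at (snd c p)) (v c))}"

definition zero_tangent :: "('a, 'e::real_normed_vector) tangent" where
  "zero_tangent = (\<lambda>c. 0)"

definition tangent_bundle ::
    "('a, 'e::real_normed_vector) chart set \<Rightarrow> ('a \<times> ('a, 'e) tangent) set" where
  "tangent_bundle A = Sigma UNIV (tangent_space A)"

text \<open>
  The chart of the tangent bundle induced by \<open>c\<close>, with image \<open>(snd c ` fst c) \<times> UNIV\<close>.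
  These charts define both the topology and the smooth structure of the tangent bundle.
\<close>

definition bundle_chart :: "('a, 'e::real_normed_vector) chart set \<Rightarrow> ('a, 'e) chart \<Rightarrow>
    ('a \<times> ('a, 'e) tangent, 'e \<times> 'e) chart" where
  "bundle_chart A c = (Sigma (fst c) (tangent_space A), \<lambda>(p, v). (snd c p, v c))"


section \<open>Finsler manifolds\<close>

text \<open>Hessian of \<open>F\<^sup>2/2\<close> along the fibre over \<open>p\<close>, at \<open>v\<close>, evaluated at \<open>(a, b)\<close>.\<close>

definition fibre_hessian :: "('a \<times> ('a, 'e::real_normed_vector) tangent \<Rightarrow> real) \<Rightarrow> 'a \<Rightarrow>
    ('a, 'e) tangent \<Rightarrow> ('a, 'e) tangent \<Rightarrow> ('a, 'e) tangent \<Rightarrow> real" where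
  "fibre_hessian F p v a b =
     deriv (\<lambda>s. deriv (\<lambda>t. (F (p, \<lambda>c. v c + s *\<^sub>R a c + t *\<^sub>R b c))\<^sup>2 / 2) 0) 0"

locale finsler_manifold = smooth_manifold A
  for A :: "('a::t2_space, 'e::{real_normed_vector, heine_borel}) chart set" +
  fixes F :: "'a \<times> ('a, 'e) tangent \<Rightarrow> real"
  assumes F_nonneg: "\<And>x. x \<in> tangent_bundle A \<Longrightarrow> 0 \<le> F x"
    and F_continuous: "\<And>c. c \<in> A \<Longrightarrow>
          continuous_on (snd (bundle_chart A c) ` fst (bundle_chart A c))
            (F \<circ> chart_inv (bundle_chart A c))"
    and F_smooth: "\<And>c. c \<in> A \<Longrightarrow>
          smooth_on (snd (bundle_chart A c) ` {(p, v) \<in> fst (bundle_chart A c). v \<noteq> zero_tangent})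
            (F \<circ> chart_inv (bundle_chart A c))"
    and F_homogeneous: "\<And>p v l. v \<in> tangent_space A p \<Longrightarrow> 0 < l \<Longrightarrow>
          F (p, \<lambda>c. l *\<^sub>R v c) = l * F (p, v)"
    and F_hessian_pos_def: "\<And>p v a. v \<in> tangent_space A p \<Longrightarrow> a \<in> tangent_space A p \<Longrightarrow>
          v \<noteq> zero_tangent \<Longrightarrow> a \<noteq> zero_tangent \<Longrightarrow> 0 < fibre_hessian F p v a a"


section \<open>The distance of a Finsler manifold\<close>

definition smooth_curve :: "('a::topological_space, 'e::real_normed_vector) chart set \<Rightarrow>
    real \<Rightarrow> real \<Rightarrow> (real \<Rightarrow> 'a) \<Rightarrow> bool" where
  "smooth_curve A a b \<gamma> \<longleftrightarrow> continuous_on {a..b} \<gamma> \<and>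
     (\<forall>c\<in>A. smooth_on {t \<in> {a..b}. \<gamma> t \<in> fst c} (snd c \<circ> \<gamma>))"

definition piecewise_smooth_curve :: "('a::topological_space, 'e::real_normed_vector) chart set \<Rightarrow>
    real \<Rightarrow> real \<Rightarrow> (real \<Rightarrow> 'a) \<Rightarrow> bool" where
  "piecewise_smooth_curve A a b \<gamma> \<longleftrightarrow>
     (\<exists>(n::nat) \<tau>. \<tau> 0 = a \<and> \<tau> n = b \<and>
        (\<forall>i<n. \<tau> i < \<tau> (Suc i) \<and> smooth_curve A (\<tau> i) (\<tau> (Suc i)) \<gamma>))"

text \<open>
  At the finitely many break points of a piecewise smooth curve the velocity may be a junk value;
  this does not affect the length integral.
\<close>

definition velocity :: "('a, 'e::real_normed_vector) chart set \<Rightarrow> real \<Rightarrow> real \<Rightarrow>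
    (real \<Rightarrow> 'a) \<Rightarrow> real \<Rightarrow> ('a, 'e) tangent" where
  "velocity A a b \<gamma> s =
     (\<lambda>c. if c \<in> A \<and> \<gamma> s \<in> fst c
          then vector_derivative (snd c \<circ> \<gamma>) (at s within {a..b}) else 0)"

definition finsler_length :: "('a, 'e::real_normed_vector) chart set \<Rightarrow>
    ('a \<times> ('a, 'e) tangent \<Rightarrow> real) \<Rightarrow> real \<Rightarrow> real \<Rightarrow> (real \<Rightarrow> 'a) \<Rightarrow> real" where
  "finsler_length A F a b \<gamma> = integral {a..b} (\<lambda>s. F (\<gamma> s, velocity A a b \<gamma> s))"

definition finsler_dist :: "('a::topological_space, 'e::real_normed_vector) chart set \<Rightarrow>
    ('a \<times> ('a, 'e) tangent \<Rightarrow> real) \<Rightarrow> 'a \<Rightarrow> 'a \<Rightarrow> real" where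
  "finsler_dist A F p q =
     Inf {finsler_length A F a b \<gamma> | a b \<gamma>.
            a < b \<and> piecewise_smooth_curve A a b \<gamma> \<and> \<gamma> a = p \<and> \<gamma> b = q}"

definition forward_ball :: "('a::topological_space, 'e::real_normed_vector) chart set \<Rightarrow>
    ('a \<times> ('a, 'e) tangent \<Rightarrow> real) \<Rightarrow> 'a \<Rightarrow> real \<Rightarrow> 'a set" where
  "forward_ball A F p r = {x. finsler_dist A F p x < r}"

definition backward_ball :: "('a::topological_space, 'e::real_normed_vector) chart set \<Rightarrow>
    ('a \<times> ('a, 'e) tangent \<Rightarrow> real) \<Rightarrow> 'a \<Rightarrow> real \<Rightarrow> 'a set" where
  "backward_ball A F p r = {x. finsler_dist A F x p < r}"

definition sym_dist :: "('a::topological_space, 'e::real_normed_vector) chart set \<Rightarrow>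
    ('a \<times> ('a, 'e) tangent \<Rightarrow> real) \<Rightarrow> 'a \<Rightarrow> 'a \<Rightarrow> real" where
  "sym_dist A F p q = (finsler_dist A F p q + finsler_dist A F q p) / 2"

definition sym_ball :: "('a::topological_space, 'e::real_normed_vector) chart set \<Rightarrow>
    ('a \<times> ('a, 'e) tangent \<Rightarrow> real) \<Rightarrow> 'a \<Rightarrow> real \<Rightarrow> 'a set" where
  "sym_ball A F x r = {y. sym_dist A F x y < r}"

end

theory Submission
  imports Defs
begin

text \<open>
  Everything rests on the topology of \<open>M\<close> seeing \<open>d\<close>.  In a chart, on a compact set of
  base points, homogeneity and \<open>F > 0\<close> off the zero section give \<open>m |u| \<le> F \<le> C |u|\<close>.
  The upper bound, applied to coordinate segments, shows that \<open>d\<close> is finite (by connectedness) and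
  continuous; the lower bound shows that a curve cannot leave a coordinate ball without
  a definite length, so \<open>d\<close> separates points.  Positivity of \<open>F\<close> itself follows from the Hessian
  condition: if \<open>F\<close> vanished at \<open>v \<noteq> 0\<close>, it would vanish on the ray through \<open>v\<close> and the Hessian
  would be degenerate in the direction \<open>v\<close>.

  By continuity, the closed ball of radius \<open>r\<close> in \<open>d\<^sub>s\<close> lies in the forward and backward balls of
  radius \<open>3r\<close>.  Conversely, \<open>d(x,z) \<le> r\<^sub>1\<close> and \<open>d(z,y) \<le> r\<^sub>2\<close> give
  \<open>d(z,x) \<le> r\<^sub>2 + d(y,x)\<close>, which bounds \<open>d\<^sub>s(x,z)\<close>.  A Cauchy sequence for \<open>d\<^sub>s\<close> stays eventually
  in a compact ball, and converges to any of its cluster points.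
\<close>

section \<open>Smooth maps\<close>

text \<open>On an open set a derivative depends only on values inside the set, so agreement of
  \<open>f\<close> and \<open>g\<close> passes to their directional derivatives and the induction
  runs over arbitrary pairs.\<close>

lemma Ck_on_cong:
  assumes "open S" "\<And>x. x \<in> S \<Longrightarrow> f x = g x"
  shows "Ck_on k S f \<longleftrightarrow> Ck_on k S g"
  using assms(2)
proof (induction k arbitrary: f g)
  case 0
  then show ?case by (auto cong: continuous_on_cong)
next
  case (Suc k)
  have D: "(f has_derivative D) (at x) \<longleftrightarrow> (g has_derivative D) (at x)" if "x \<in> S" for x D
    using has_derivative_transform_within_open[OF _ assms(1) that] Suc.prems by metis
  then have "f differentiable (at x) \<longleftrightarrow> g differentiable (at x)"
    and "frechet_derivative f (at x) = frechet_derivative g (at x)" if "x \<in> S" for x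
    using that by (simp_all add: differentiable_def frechet_derivative_def)
  with Suc.IH[of "\<lambda>x. frechet_derivative f (at x) h" "\<lambda>x. frechet_derivative g (at x) h" for h]
  show ?case by simp
qed

lemma smooth_on_differentiable:
  assumes "smooth_on S f" "open S" "x \<in> S"
  shows "f differentiable (at x)"
proof -
  obtain T g where T: "open T" "x \<in> T" "\<forall>y\<in>S \<inter> T. f y = g y" "\<And>k. Ck_on k T g"
    using assms unfolding smooth_on_def by metis
  have "g differentiable (at x)"
    using T(4)[of "Suc 0"] T(2) by simp
  then obtain D where "(g has_derivative D) (at x)" by (auto simp: differentiable_def)
  then have "(f has_derivative D) (at x)"
    by (rule has_derivative_transform_within_open[of _ _ _ _ "S \<inter> T"]) (use T assms in auto)
  then show ?thesis by (auto simp: differentiable_def)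
qed

text \<open>By the chain rule, differentiating the restriction of \<open>g\<close> to a line gives
  the restriction of a directional derivative of \<open>g\<close> to the same line, so an induction
  over arbitrary \<open>g\<close> closes.\<close>

lemma Ck_on_affine:
  fixes g :: "'e::real_normed_vector \<Rightarrow> 'f::real_normed_vector" and x u :: 'e
  assumes "open T" "Ck_on k T g"
  shows "Ck_on k ((\<lambda>t. x + t *\<^sub>R u) -` T) (g \<circ> (\<lambda>t. x + t *\<^sub>R u))"
  using assms(2)
proof (induction k arbitrary: g)
  case 0
  then show ?case
    unfolding o_def by (auto intro!: continuous_on_compose2[of T g] continuous_intros)
next
  case (Suc k)
  let ?l = "\<lambda>t. x + t *\<^sub>R u"
  have op: "open (?l -` T)"
    by (rule continuous_open_vimage[OF assms(1)]) (intro continuous_intros)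
  have D: "(g \<circ> ?l has_derivative (\<lambda>h. frechet_derivative g (at (?l t)) (h *\<^sub>R u))) (at t)"
    if "?l t \<in> T" for t
  proof -
    have "(?l has_derivative (\<lambda>h. h *\<^sub>R u)) (at t)"
      by (auto intro!: derivative_eq_intros)
    moreover have "(g has_derivative frechet_derivative g (at (?l t))) (at (?l t))"
      using Suc.prems that frechet_derivative_works by auto
    ultimately show ?thesis
      using diff_chain_at by (fastforce simp: o_def)
  qed
  have "Ck_on k (?l -` T) (\<lambda>t. frechet_derivative (g \<circ> ?l) (at t) h)" for h
  proof -
    have Ck: "Ck_on k (?l -` T) ((\<lambda>y. frechet_derivative g (at y) (h *\<^sub>R u)) \<circ> ?l)"
      by (rule Suc.IH) (use Suc.prems in simp)
    have eq: "frechet_derivative (g \<circ> ?l) (at t) h =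
        ((\<lambda>y. frechet_derivative g (at y) (h *\<^sub>R u)) \<circ> ?l) t" if "t \<in> ?l -` T" for t
    proof -
      from that have "?l t \<in> T" by simp
      from fun_cong[OF frechet_derivative_at[OF D[OF this]], of h] show ?thesis
        by (simp only: o_apply)
    qed
    show ?thesis
      by (rule iffD2[OF Ck_on_cong[OF op eq] Ck])
  qed
  moreover have "g \<circ> ?l differentiable (at t)" if "t \<in> ?l -` T" for t
    using D[of t] that unfolding differentiable_def by blast
  ultimately show ?case by (simp only: Ck_on.simps) blast
qed

text \<open>Serves two purposes: with \<open>u = y - x\<close> coordinate segments are smooth
  curves, with \<open>u = 1\<close> time shifts of smooth curves are smooth.\<close>

lemma smooth_on_affine:
  fixes g :: "'e::real_normed_vector \<Rightarrow> 'f::real_normed_vector" and x u :: 'e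
  assumes "smooth_on S g" "\<And>t. t \<in> R \<Longrightarrow> x + t *\<^sub>R u \<in> S"
  shows "smooth_on R (g \<circ> (\<lambda>t. x + t *\<^sub>R u))"
  unfolding smooth_on_def
proof
  fix t assume "t \<in> R"
  let ?l = "\<lambda>t. x + t *\<^sub>R u"
  obtain T h where T: "open T" "?l t \<in> T" "\<forall>y\<in>S \<inter> T. g y = h y" "\<And>k. Ck_on k T h"
    using assms \<open>t \<in> R\<close> unfolding smooth_on_def by metis
  have "open (?l -` T)"
    by (rule continuous_open_vimage[OF T(1)]) (intro continuous_intros)
  then show "\<exists>T f. open T \<and> t \<in> T \<and> (\<forall>y\<in>R \<inter> T. (g \<circ> ?l) y = f y) \<and> (\<forall>k. Ck_on k T f)"
    using T Ck_on_affine[OF T(1) T(4), of _ x u] assms(2)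
    by (intro exI[of _ "?l -` T"] exI[of _ "h \<circ> ?l"]) auto
qed

lemma smooth_on_cong:
  assumes "S = S'" "\<And>x. x \<in> S' \<Longrightarrow> f x = g x"
  shows "smooth_on S f \<longleftrightarrow> smooth_on S' g"
  using assms unfolding smooth_on_def by (metis IntD1)

section \<open>Tangent vectors in charts\<close>

lemma frechet_derivative_cong:
  assumes "open S" "x \<in> S" "\<And>y. y \<in> S \<Longrightarrow> f y = g y"
  shows "frechet_derivative f (at x) = frechet_derivative g (at x)"
proof -
  have "(f has_derivative D) (at x) \<longleftrightarrow> (g has_derivative D) (at x)" for D
    using has_derivative_transform_within_open[OF _ assms(1,2)] assms(3) by metis
  then show ?thesis by (simp add: frechet_derivative_def)
qed

context smooth_manifold
begin

lemma open_domain: "c \<in> A \<Longrightarrow> open (fst c)"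
  and open_image: "c \<in> A \<Longrightarrow> open (snd c ` fst c)"
  and chart_homeomorphism:
    "c \<in> A \<Longrightarrow> homeomorphism (fst c) (snd c ` fst c) (snd c) (chart_inv c)"
  using chart by auto

lemma chart_inv_chart [simp]: "c \<in> A \<Longrightarrow> p \<in> fst c \<Longrightarrow> chart_inv c (snd c p) = p"
  using chart_homeomorphism by (auto simp: homeomorphism_def)

lemma chart_chart_inv [simp]: "c \<in> A \<Longrightarrow> x \<in> snd c ` fst c \<Longrightarrow> snd c (chart_inv c x) = x"
  using chart_homeomorphism by (auto simp: homeomorphism_def)

lemma chart_inv_in [simp]: "c \<in> A \<Longrightarrow> x \<in> snd c ` fst c \<Longrightarrow> chart_inv c x \<in> fst c"
  by auto

lemma continuous_on_chart: "c \<in> A \<Longrightarrow> continuous_on (fst c) (snd c)"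
  and continuous_on_chart_inv: "c \<in> A \<Longrightarrow> continuous_on (snd c ` fst c) (chart_inv c)"
  using chart_homeomorphism by (auto simp: homeomorphism_def)

lemma chart_image_open:
  assumes "c \<in> A" "open W" "W \<subseteq> fst c"
  shows "open (snd c ` W)"
proof -
  have "snd c ` W = snd c ` fst c \<inter> chart_inv c -` W"
    using assms by force
  then show ?thesis
    using continuous_on_open_vimage[OF open_image[OF assms(1)], of "chart_inv c"]
      continuous_on_chart_inv[OF assms(1)] assms(2)
    by (metis inf_commute)
qed

lemma chart_inv_image_open:
  assumes "c \<in> A" "open W" "W \<subseteq> snd c ` fst c"
  shows "open (chart_inv c ` W)"
proof -
  have "chart_inv c ` W \<subseteq> fst c \<inter> snd c -` W"
    using assms(1,3) by (auto simp: subset_iff)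
  moreover have "z \<in> chart_inv c ` W" if "z \<in> fst c \<inter> snd c -` W" for z
    using that assms(1) by (metis IntD1 IntD2 chart_inv_chart image_eqI vimageE)
  ultimately have "chart_inv c ` W = fst c \<inter> snd c -` W"
    by blast
  then show ?thesis
    using continuous_on_open_vimage[OF open_domain[OF assms(1)], of "snd c"]
      continuous_on_chart[OF assms(1)] assms(2)
    by (metis inf_commute)
qed

lemma obtain_chart: obtains c where "c \<in> A" "p \<in> fst c"
  using cover by blast

text \<open>Smoothness of the coordinate changes on the open overlap makes the derivatives in
  \<open>tangent_space\<close> genuine, in particular linear.\<close>

lemma transition_has_derivative:
  assumes "c \<in> A" "c' \<in> A" "p \<in> fst c" "p \<in> fst c'"
  shows "(snd c' \<circ> chart_inv c has_derivative
    frechet_derivative (snd c' \<circ> chart_inv c) (at (snd c p))) (at (snd c p))"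
proof -
  have "open (snd c ` (fst c \<inter> fst c'))"
    using assms by (intro chart_image_open) (auto intro: open_domain)
  from smooth_on_differentiable[OF compatible[OF assms(1,2)] this] assms
  show ?thesis by (simp add: frechet_derivative_works[symmetric] del: o_apply)
qed

text \<open>Chain rule: on the image of the overlap of \<open>c\<close> and \<open>c1\<close> the
  middle factors \<open>snd c1\<close> and \<open>chart_inv c1\<close> cancel, leaving the direct
  coordinate change.\<close>

lemma transition_cocycle:
  assumes "c \<in> A" "c1 \<in> A" "c2 \<in> A" "p \<in> fst c" "p \<in> fst c1" "p \<in> fst c2"
  shows "frechet_derivative (snd c2 \<circ> chart_inv c1) (at (snd c1 p))
      (frechet_derivative (snd c1 \<circ> chart_inv c) (at (snd c p)) u) =
    frechet_derivative (snd c2 \<circ> chart_inv c) (at (snd c p)) u"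
proof -
  let ?D1 = "frechet_derivative (snd c1 \<circ> chart_inv c) (at (snd c p))"
  let ?D2 = "frechet_derivative (snd c2 \<circ> chart_inv c1) (at (snd c1 p))"
  have eq: "snd c1 p = (snd c1 \<circ> chart_inv c) (snd c p)" using assms by simp
  have "(snd c2 \<circ> chart_inv c1 has_derivative ?D2) (at ((snd c1 \<circ> chart_inv c) (snd c p)))"
    unfolding eq[symmetric] by (rule transition_has_derivative) (use assms in auto)
  with transition_has_derivative[OF assms(1,2,4,5)]
  have "((snd c2 \<circ> chart_inv c1) \<circ> (snd c1 \<circ> chart_inv c) has_derivative ?D2 \<circ> ?D1) (at (snd c p))"
    by (rule diff_chain_at)
  from frechet_derivative_at[OF this]
  have "?D2 \<circ> ?D1 = frechet_derivative ((snd c2 \<circ> chart_inv c1) \<circ> (snd c1 \<circ> chart_inv c)) (at (snd c p))" .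
  also have "\<dots> = frechet_derivative (snd c2 \<circ> chart_inv c) (at (snd c p))"
    by (rule frechet_derivative_cong[of "snd c ` (fst c \<inter> fst c1)"])
      (use assms in \<open>auto intro!: chart_image_open open_domain\<close>)
  finally show ?thesis by (metis o_apply)
qed

text \<open>The vector \<open>u\<close> is transported from \<open>c\<close> to every other chart by
  the derivative of the coordinate change; the cocycle rule makes the resulting family
  consistent.\<close>

lemma tangent_space_surj:
  assumes "c \<in> A" "p \<in> fst c"
  obtains v where "v \<in> tangent_space A p" "v c = u"
proof
  let ?v = "\<lambda>c'. if c' \<in> A \<and> p \<in> fst c'
    then frechet_derivative (snd c' \<circ> chart_inv c) (at (snd c p)) u else 0"
  show "?v \<in> tangent_space A p"
    using assms by (auto simp: tangent_space_def intro!: transition_cocycle[symmetric] simp del: o_apply)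
  have "frechet_derivative (snd c \<circ> chart_inv c) (at (snd c p)) = frechet_derivative id (at (snd c p))"
    by (rule frechet_derivative_cong[of "snd c ` fst c"]) (use assms in \<open>auto intro!: open_image\<close>)
  then show "?v c = u" using assms by simp
qed

lemma tangent_space_outside:
  assumes "v \<in> tangent_space A p" "\<not> (c \<in> A \<and> p \<in> fst c)"
  shows "v c = 0"
  using assms unfolding tangent_space_def by blast

lemma tangent_space_transition:
  assumes "v \<in> tangent_space A p" "c \<in> A" "c' \<in> A" "p \<in> fst c" "p \<in> fst c'"
  shows "v c' = frechet_derivative (snd c' \<circ> chart_inv c) (at (snd c p)) (v c)"
  using assms unfolding tangent_space_def by blast

lemma tangent_eqI:
  assumes "v \<in> tangent_space A p" "w \<in> tangent_space A p" "c \<in> A" "p \<in> fst c" "v c = w c"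
  shows "v = w"
proof
  fix c'
  show "v c' = w c'"
    using tangent_space_transition[OF assms(1,3) _ assms(4), of c']
      tangent_space_transition[OF assms(2,3) _ assms(4), of c']
      tangent_space_outside[OF assms(1), of c'] tangent_space_outside[OF assms(2), of c'] assms(5)
    by (cases "c' \<in> A \<and> p \<in> fst c'") metis+
qed

section \<open>Coordinates on the tangent bundle\<close>

lemma bundle_chart_image:
  assumes "c \<in> A"
  shows "snd (bundle_chart A c) ` fst (bundle_chart A c) = (snd c ` fst c) \<times> UNIV"
proof -
  have "(snd c p, u) \<in> snd (bundle_chart A c) ` fst (bundle_chart A c)" if p: "p \<in> fst c" for p u
  proof -
    obtain v where "v \<in> tangent_space A p" "v c = u"
      using tangent_space_surj[OF assms p] by metis
    with p show ?thesis by (force simp: bundle_chart_def)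
  qed
  then show ?thesis by (auto simp: bundle_chart_def)
qed

lemma bundle_chart_inv:
  assumes "c \<in> A" "p \<in> fst c" "v \<in> tangent_space A p"
  shows "chart_inv (bundle_chart A c) (snd c p, v c) = (p, v)"
proof -
  have "inj_on (snd (bundle_chart A c)) (fst (bundle_chart A c))"
  proof (rule inj_onI, clarsimp simp: bundle_chart_def)
    fix q w q' w'
    assume *: "q \<in> fst c" "w \<in> tangent_space A q" "q' \<in> fst c" "w' \<in> tangent_space A q'"
      "snd c q = snd c q'" "w c = w' c"
    then have "q = q'" using chart_inv_chart[OF assms(1)] by metis
    with * show "q = q' \<and> w = w'" using tangent_eqI[OF _ _ assms(1)] by blast
  qed
  then have "the_inv_into (fst (bundle_chart A c)) (snd (bundle_chart A c))
      (snd (bundle_chart A c) (p, v)) = (p, v)"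
    by (rule the_inv_into_f_f) (use assms in \<open>auto simp: bundle_chart_def\<close>)
  then show ?thesis by (simp add: chart_inv_def bundle_chart_def)
qed

end

section \<open>The Finsler metric in charts\<close>

context finsler_manifold
begin

text \<open>The local coordinate expression of \<open>F\<close>, on which the compactness and
  continuity arguments operate.\<close>

definition coord_F :: "('a, 'e) chart \<Rightarrow> 'e \<Rightarrow> 'e \<Rightarrow> real" where
  "coord_F c x u = F (chart_inv (bundle_chart A c) (x, u))"

lemma coord_F_eq:
  assumes "c \<in> A" "p \<in> fst c" "v \<in> tangent_space A p"
  shows "F (p, v) = coord_F c (snd c p) (v c)"
  using bundle_chart_inv[OF assms] by (simp add: coord_F_def)

lemma coord_F_obtain:
  assumes "c \<in> A" "x \<in> snd c ` fst c"
  obtains p v where "p \<in> fst c" "snd c p = x" "v \<in> tangent_space A p" "v c = u"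
    "coord_F c x u = F (p, v)"
proof -
  obtain p where p: "p \<in> fst c" "snd c p = x" using assms by blast
  obtain v where "v \<in> tangent_space A p" "v c = u"
    using tangent_space_surj[OF assms(1) p(1)] by metis
  with p coord_F_eq[OF assms(1) p(1), of v] show thesis by (intro that[of p v]) auto
qed

lemma continuous_on_coord_F:
  assumes "c \<in> A"
  shows "continuous_on ((snd c ` fst c) \<times> UNIV) (\<lambda>z. coord_F c (fst z) (snd z))"
  using F_continuous[OF assms] unfolding bundle_chart_image[OF assms]
  by (simp add: coord_F_def o_def)

lemma tangent_space_scale:
  assumes "v \<in> tangent_space A p"
  shows "(\<lambda>c. l *\<^sub>R v c) \<in> tangent_space A p"
proof -
  have "l *\<^sub>R v c' = frechet_derivative (snd c' \<circ> chart_inv c) (at (snd c p)) (l *\<^sub>R v c)"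
    if "c \<in> A" "c' \<in> A" "p \<in> fst c" "p \<in> fst c'" for c c'
  proof -
    interpret D: bounded_linear "frechet_derivative (snd c' \<circ> chart_inv c) (at (snd c p))"
      using transition_has_derivative[OF that] by (rule has_derivative_bounded_linear)
    have "v c' = frechet_derivative (snd c' \<circ> chart_inv c) (at (snd c p)) (v c)"
      by (rule tangent_space_transition[OF assms that])
    then show ?thesis by (simp only: D.scaleR)
  qed
  moreover have "l *\<^sub>R v c = 0" if "\<not> (c \<in> A \<and> p \<in> fst c)" for c
    using tangent_space_outside[OF assms that] by simp
  ultimately show ?thesis unfolding tangent_space_def by blast
qed

lemma coord_F_scale:
  assumes "c \<in> A" "x \<in> snd c ` fst c" "0 < l"
  shows "coord_F c x (l *\<^sub>R u) = l * coord_F c x u"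
proof -
  obtain p v where p: "p \<in> fst c" "snd c p = x" "v \<in> tangent_space A p" "v c = u"
    "coord_F c x u = F (p, v)"
    using coord_F_obtain[OF assms(1,2)] by metis
  with coord_F_eq[OF assms(1) p(1) tangent_space_scale[OF p(3)]] F_homogeneous[OF p(3) assms(3)]
  show ?thesis by simp
qed

text \<open>Homogeneity is given for positive factors, so the factor 2 is used: the value at 0
  equals its own double.\<close>

lemma coord_F_zero:
  assumes "c \<in> A" "x \<in> snd c ` fst c"
  shows "coord_F c x 0 = 0"
  using coord_F_scale[OF assms, of 2 0] by simp

section \<open>Positivity of the metric and local comparison with the norm\<close>

lemma F_pos:
  assumes "v \<in> tangent_space A p" "v \<noteq> zero_tangent"
  shows "0 < F (p, v)"
proof (rule ccontr)
  assume "\<not> 0 < F (p, v)"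
  then have 0: "F (p, v) = 0"
    using F_nonneg[of "(p, v)"] assms by (force simp: tangent_bundle_def)
  \<comment> \<open>For these \<open>s\<close> and \<open>t\<close> the factor
    \<open>1 + s + t\<close> is positive, so homogeneity applies.\<close>
  have F0: "F (p, \<lambda>c. v c + s *\<^sub>R v c + t *\<^sub>R v c) = 0" if "\<bar>s\<bar> < 1 / 2" "\<bar>t\<bar> < 1 / 2" for s t :: real
  proof -
    have "(\<lambda>c. v c + s *\<^sub>R v c + t *\<^sub>R v c) = (\<lambda>c. (1 + s + t) *\<^sub>R v c)"
      by (simp add: scaleR_add_left)
    with F_homogeneous[OF assms(1), of "1 + s + t"] that 0 show ?thesis by simp
  qed
  \<comment> \<open>A derivative at 0 depends only on values near 0, so vanishing for small
    \<open>s\<close> and \<open>t\<close> settles both derivatives of the Hessian.\<close>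
  have small: "\<forall>\<^sub>F t in nhds 0. \<bar>t::real\<bar> < 1 / 2"
    using eventually_nhds_in_open[of "{- 1 / 2 <..< 1 / 2}" "0::real"]
    by (auto elim!: eventually_mono simp: abs_less_iff)
  have inner: "deriv (\<lambda>t. (F (p, \<lambda>c. v c + s *\<^sub>R v c + t *\<^sub>R v c))\<^sup>2 / 2) 0 = 0" if "\<bar>s\<bar> < 1 / 2" for s :: real
  proof -
    have "deriv (\<lambda>t. (F (p, \<lambda>c. v c + s *\<^sub>R v c + t *\<^sub>R v c))\<^sup>2 / 2) 0 = deriv (\<lambda>t. 0::real) 0"
      by (rule deriv_cong_ev) (use small F0[OF that] in \<open>auto elim!: eventually_mono\<close>)
    then show ?thesis by simp
  qed
  have "fibre_hessian F p v v v = deriv (\<lambda>t. 0::real) 0"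
    unfolding fibre_hessian_def
    by (rule deriv_cong_ev) (use small inner in \<open>auto elim!: eventually_mono\<close>)
  with F_hessian_pos_def[OF assms(1) assms(1) assms(2) assms(2)] show False by simp
qed

lemma coord_F_pos:
  assumes "c \<in> A" "x \<in> snd c ` fst c" "u \<noteq> 0"
  shows "0 < coord_F c x u"
proof -
  obtain p v where p: "v \<in> tangent_space A p" "v c = u" "coord_F c x u = F (p, v)"
    using coord_F_obtain[OF assms(1,2)] by metis
  with F_pos[OF p(1)] assms(3) show ?thesis by (auto simp: zero_tangent_def)
qed

text \<open>On the compact set \<open>K \<times> sphere 0 1\<close> the continuous function is
  bounded and stays away from 0; homogeneity carries both bounds to all vectors.\<close>

lemma coord_F_bounds:
  assumes "c \<in> A" "compact K" "K \<subseteq> snd c ` fst c"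
  obtains m C where "0 < m" "0 \<le> C"
    "\<And>x u. x \<in> K \<Longrightarrow> m * norm u \<le> coord_F c x u"
    "\<And>x u. x \<in> K \<Longrightarrow> coord_F c x u \<le> C * norm u"
proof -
  let ?S = "K \<times> sphere 0 1 :: ('e \<times> 'e) set"
  let ?f = "\<lambda>z. coord_F c (fst z) (snd z)"
  have "bounded (sphere 0 1 :: 'e set)"
    by (rule bounded_subset[OF bounded_cball[of 0 1]]) auto
  moreover have "closed (sphere 0 1 :: 'e set)"
    unfolding sphere_def by (intro closed_Collect_eq continuous_intros)
  ultimately have "compact (sphere 0 1 :: 'e set)"
    by (simp add: compact_eq_bounded_closed)
  then have cpt: "compact ?S" using assms(2) by (rule compact_Times[rotated])
  have cont: "continuous_on ?S ?f"
    using continuous_on_coord_F[OF assms(1)] by (rule continuous_on_subset) (use assms(3) in auto)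
  \<comment> \<open>The product is empty if \<open>K\<close> is empty or the model space has
    dimension 0; any positive \<open>m\<close> serves then.\<close>
  have "\<exists>m>0. \<forall>z\<in>?S. m \<le> ?f z"
  proof (cases "?S = {}")
    case True
    then show ?thesis by (auto intro: exI[of _ 1])
  next
    case False
    obtain z where z: "z \<in> ?S" "\<forall>y\<in>?S. ?f z \<le> ?f y"
      using continuous_attains_inf[OF cpt False cont] by blast
    moreover have "0 < ?f z"
      using z(1) assms by (intro coord_F_pos) auto
    ultimately show ?thesis by blast
  qed
  then obtain m where m: "m > 0" "\<forall>z\<in>?S. m \<le> ?f z" by blast
  have "bdd_above (?f ` ?S)"
    using compact_continuous_image[OF cont cpt] by (intro bounded_imp_bdd_above compact_imp_bounded)
  then obtain C0 where C0: "\<forall>z\<in>?S. ?f z \<le> C0" by (auto simp: bdd_above_def)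
  define C where "C = max 0 C0"
  have C: "0 \<le> C" "\<forall>z\<in>?S. ?f z \<le> C" using C0 unfolding C_def by (simp, meson max.coboundedI2)
  have main: "m * norm u \<le> coord_F c x u \<and> coord_F c x u \<le> C * norm u" if "x \<in> K" for x u
  proof (cases "u = 0")
    case True
    then show ?thesis using coord_F_zero[OF assms(1)] that assms(3) by auto
  next
    case False
    define w where "w = u /\<^sub>R norm u"
    have "(x, w) \<in> ?S" using that False by (simp add: w_def)
    then have w: "m \<le> coord_F c x w" "coord_F c x w \<le> C" using m C by force+
    have "coord_F c x u = coord_F c x (norm u *\<^sub>R w)" using False by (simp add: w_def)
    also have "\<dots> = norm u * coord_F c x w"
      by (rule coord_F_scale) (use that assms False in auto)
    finally show ?thesis using w by (metis mult.commute mult_left_mono norm_ge_zero)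
  qed
  show thesis using that[OF m(1) C(1)] main by blast
qed

section \<open>Curves and their lengths\<close>

lemma smooth_curve_chart_preimage:
  assumes "smooth_curve A a b \<gamma>" "c \<in> A"
  obtains W where "open W" "{a..b} \<inter> W = {t \<in> {a..b}. \<gamma> t \<in> fst c}"
proof -
  have "continuous_on {a..b} \<gamma>" using assms by (simp add: smooth_curve_def)
  then have "openin (top_of_set {a..b}) ({a..b} \<inter> \<gamma> -` fst c)"
    using open_domain[OF assms(2)] by (rule continuous_openin_preimage_gen)
  then obtain W where "open W" "{a..b} \<inter> \<gamma> -` fst c = {a..b} \<inter> W" by (auto simp: openin_open)
  with that show thesis by blast
qed

text \<open>Near \<open>s\<close> the coordinate curve is the restriction of a smooth map, whose
  derivative supplies a continuous velocity; at an end point of \<open>{a..b}\<close> this is the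
  one-sided derivative.\<close>

lemma smooth_curve_local:
  assumes "smooth_curve A a b \<gamma>" "c \<in> A" "s \<in> {a..b}" "\<gamma> s \<in> fst c"
  obtains T g where "open T" "s \<in> T" "continuous_on T g"
    "\<And>t. t \<in> {a..b} \<inter> T \<Longrightarrow> \<gamma> t \<in> fst c \<and> (snd c \<circ> \<gamma> has_vector_derivative g t) (at t within {a..b})"
proof -
  obtain W where W: "open W" "{a..b} \<inter> W = {t \<in> {a..b}. \<gamma> t \<in> fst c}"
    using smooth_curve_chart_preimage[OF assms(1,2)] .
  have "smooth_on ({a..b} \<inter> W) (snd c \<circ> \<gamma>)"
    using assms(1,2) W by (simp add: smooth_curve_def)
  moreover have s: "s \<in> {a..b} \<inter> W" using assms W by blast
  ultimately obtain T h where T: "open T" "s \<in> T" "\<forall>y\<in>({a..b} \<inter> W) \<inter> T. (snd c \<circ> \<gamma>) y = h y"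
    "\<And>k. Ck_on k T h" unfolding smooth_on_def by meson
  let ?g = "\<lambda>t. frechet_derivative h (at t) 1"
  show thesis
  proof (rule that)
    \<comment> \<open>Shrinking \<open>T\<close> by \<open>W\<close> keeps the curve inside the
      domain of \<open>c\<close>.\<close>
    show "open (T \<inter> W)" "s \<in> T \<inter> W" using T W s by auto
    have "continuous_on T ?g" using T(4)[of "Suc 0"] by simp
    then show "continuous_on (T \<inter> W) ?g" by (rule continuous_on_subset) simp
    fix t assume t: "t \<in> {a..b} \<inter> (T \<inter> W)"
    have "(h has_vector_derivative ?g t) (at t)"
    proof -
      have "h differentiable (at t)"
        using T(4)[of "Suc 0"] t by simp
      then have d: "(h has_derivative frechet_derivative h (at t)) (at t)"
        by (rule iffD1[OF frechet_derivative_works])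
      interpret D: bounded_linear "frechet_derivative h (at t)"
        using d by (rule has_derivative_bounded_linear)
      have "frechet_derivative h (at t) x = x *\<^sub>R ?g t" for x
        using D.scaleR[of x 1] unfolding real_scaleR_def mult_1_right .
      then have "frechet_derivative h (at t) = (\<lambda>x. x *\<^sub>R ?g t)" ..
      with d show ?thesis
        unfolding has_vector_derivative_def by (rule has_derivative_eq_rhs)
    qed
    then have "(h has_vector_derivative ?g t) (at t within {a..b} \<inter> (T \<inter> W))"
      by (rule has_vector_derivative_at_within)
    then have "(snd c \<circ> \<gamma> has_vector_derivative ?g t) (at t within {a..b} \<inter> (T \<inter> W))"
      by (rule has_vector_derivative_transform[rotated 2]) (use t T in auto)
    moreover have eq: "at t within {a..b} \<inter> (T \<inter> W) = at t within {a..b}"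
      by (rule at_within_nhd[of _ "T \<inter> W"]) (use t T W in auto)
    ultimately have "(snd c \<circ> \<gamma> has_vector_derivative ?g t) (at t within {a..b})"
      by (simp only: eq)
    moreover have "\<gamma> t \<in> fst c" using t W(2) by blast
    ultimately show "\<gamma> t \<in> fst c \<and> (snd c \<circ> \<gamma> has_vector_derivative ?g t) (at t within {a..b})"
      by blast
  qed
qed

section \<open>Velocity vectors and their Finsler norm\<close>

lemma velocity_has_vector_derivative:
  assumes "smooth_curve A a b \<gamma>" "a < b" "c \<in> A" "s \<in> {a..b}" "\<gamma> s \<in> fst c"
  shows "(snd c \<circ> \<gamma> has_vector_derivative velocity A a b \<gamma> s c) (at s within {a..b})"
proof -
  obtain v where v: "(snd c \<circ> \<gamma> has_vector_derivative v) (at s within {a..b})"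
    using smooth_curve_local[OF assms(1,3,4,5)] assms(4) by (metis IntI)
  then have "vector_derivative (snd c \<circ> \<gamma>) (at s within {a..b}) = v"
    using vector_derivative_within_cbox[of a b s] assms by simp
  with v show ?thesis using assms by (simp add: velocity_def)
qed

lemma velocity_unique:
  assumes "(snd c \<circ> \<gamma> has_vector_derivative v) (at s within {a..b})"
    "a < b" "c \<in> A" "s \<in> {a..b}" "\<gamma> s \<in> fst c"
  shows "velocity A a b \<gamma> s c = v"
  using vector_derivative_within_cbox[of a b s] assms by (simp add: velocity_def)

text \<open>Chain rule for the coordinate change, applied on the part
  \<open>{a..b} \<inter> W\<close> of the interval where the curve stays in \<open>fst c\<close>;
  this part is a neighbourhood of \<open>s\<close> in the interval.\<close>

lemma velocity_in_tangent_space: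
  assumes "smooth_curve A a b \<gamma>" "a < b" "s \<in> {a..b}"
  shows "velocity A a b \<gamma> s \<in> tangent_space A (\<gamma> s)"
proof -
  have "velocity A a b \<gamma> s c' =
      frechet_derivative (snd c' \<circ> chart_inv c) (at (snd c (\<gamma> s))) (velocity A a b \<gamma> s c)"
    if c: "c \<in> A" "c' \<in> A" "\<gamma> s \<in> fst c" "\<gamma> s \<in> fst c'" for c c'
  proof (rule velocity_unique)
    let ?D = "frechet_derivative (snd c' \<circ> chart_inv c) (at (snd c (\<gamma> s)))"
    obtain W where W: "open W" "{a..b} \<inter> W = {t \<in> {a..b}. \<gamma> t \<in> fst c}"
      using smooth_curve_chart_preimage[OF assms(1) c(1)] .
    have eq: "at s within {a..b} \<inter> W = at s within {a..b}"
      by (rule at_within_nhd[of _ W]) (use W assms(3) c(3) in auto)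
    have 1: "(snd c \<circ> \<gamma> has_vector_derivative velocity A a b \<gamma> s c) (at s within {a..b} \<inter> W)"
      using velocity_has_vector_derivative[OF assms(1,2) c(1) assms(3) c(3)] unfolding eq .
    have 2: "(snd c' \<circ> chart_inv c has_derivative ?D)
        (at ((snd c \<circ> \<gamma>) s) within (snd c \<circ> \<gamma>) ` ({a..b} \<inter> W))"
      using has_derivative_at_withinI[OF transition_has_derivative[OF c]] by simp
    from vector_derivative_diff_chain_within[OF 1 2]
    have "((snd c' \<circ> chart_inv c) \<circ> (snd c \<circ> \<gamma>) has_vector_derivative
        ?D (velocity A a b \<gamma> s c)) (at s within {a..b} \<inter> W)" .
    then have "(snd c' \<circ> \<gamma> has_vector_derivative
        ?D (velocity A a b \<gamma> s c)) (at s within {a..b} \<inter> W)"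
      by (rule has_vector_derivative_transform[rotated 2]) (use assms c W in auto)
    then show "(snd c' \<circ> \<gamma> has_vector_derivative
        ?D (velocity A a b \<gamma> s c)) (at s within {a..b})" unfolding eq .
  qed (use assms c in auto)
  moreover have "velocity A a b \<gamma> s c = 0" if "\<not> (c \<in> A \<and> \<gamma> s \<in> fst c)" for c
    using that by (auto simp: velocity_def)
  ultimately show ?thesis unfolding tangent_space_def by blast
qed

lemma F_velocity:
  assumes "smooth_curve A a b \<gamma>" "a < b" "s \<in> {a..b}" "c \<in> A" "\<gamma> s \<in> fst c"
  shows "F (\<gamma> s, velocity A a b \<gamma> s) = coord_F c (snd c (\<gamma> s)) (velocity A a b \<gamma> s c)"
  using velocity_in_tangent_space[OF assms(1,2,3)] by (rule coord_F_eq[OF assms(4,5)])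

lemma F_velocity_nonneg:
  assumes "smooth_curve A a b \<gamma>" "a < b" "s \<in> {a..b}"
  shows "0 \<le> F (\<gamma> s, velocity A a b \<gamma> s)"
  using F_nonneg velocity_in_tangent_space[OF assms] by (simp add: tangent_bundle_def)

text \<open>Locally the integrand is \<open>coord_F c\<close> evaluated along a continuous position
  and a continuous coordinate velocity. Hence the length integral of a smooth piece exists.\<close>

lemma continuous_on_F_velocity:
  assumes "smooth_curve A a b \<gamma>" "a < b"
  shows "continuous_on {a..b} (\<lambda>s. F (\<gamma> s, velocity A a b \<gamma> s))"
  unfolding continuous_on_eq_continuous_within
proof
  fix s assume s: "s \<in> {a..b}"
  obtain c where c: "c \<in> A" "\<gamma> s \<in> fst c" using obtain_chart .
  obtain T g where T: "open T" "s \<in> T" "continuous_on T g"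
    "\<And>t. t \<in> {a..b} \<inter> T \<Longrightarrow> \<gamma> t \<in> fst c \<and> (snd c \<circ> \<gamma> has_vector_derivative g t) (at t within {a..b})"
    by (rule smooth_curve_local[OF assms(1) c(1) s c(2)]) blast
  let ?S = "{a..b} \<inter> T"
  have F: "F (\<gamma> t, velocity A a b \<gamma> t) = coord_F c (snd c (\<gamma> t)) (g t)" if "t \<in> ?S" for t
    using that T(4)[OF that] F_velocity[OF assms _ c(1)] velocity_unique[OF _ assms(2) c(1)] by auto
  have "continuous_on ?S (\<lambda>t. snd c (\<gamma> t))"
    by (rule continuous_on_compose2[OF continuous_on_chart[OF c(1)]])
      (use assms(1) T(4) in \<open>auto simp: smooth_curve_def intro: continuous_on_subset\<close>)
  then have "continuous_on ?S (\<lambda>t. (snd c (\<gamma> t), g t))"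
    using T(3) by (intro continuous_on_Pair) (auto intro: continuous_on_subset)
  then have "continuous_on ?S (\<lambda>t. (\<lambda>z. coord_F c (fst z) (snd z)) (snd c (\<gamma> t), g t))"
    by (rule continuous_on_compose2[OF continuous_on_coord_F[OF c(1)]]) (use T(4) in auto)
  then have "continuous_on ?S (\<lambda>s. F (\<gamma> s, velocity A a b \<gamma> s))"
    by (rule continuous_on_eq) (simp add: F)
  then have "continuous (at s within ?S) (\<lambda>s. F (\<gamma> s, velocity A a b \<gamma> s))"
    using s T(2) by (simp add: continuous_on_eq_continuous_within)
  moreover have "at s within ?S = at s within {a..b}"
    by (rule at_within_nhd[of _ T]) (use T in auto)
  ultimately show "continuous (at s within {a..b}) (\<lambda>s. F (\<gamma> s, velocity A a b \<gamma> s))"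
    by (metis continuous_within)
qed

end

section \<open>Piecewise smooth curves\<close>

text \<open>Having derivative \<open>v\<close> is equivalent on both sides, by shifting forth and
  back, so the choice in \<open>vector_derivative\<close> is the same even where no derivative
  exists.\<close>

lemma vector_derivative_shift:
  fixes f :: "real \<Rightarrow> 'b::real_normed_vector"
  shows "vector_derivative (\<lambda>t. f (t + d)) (at s) = vector_derivative f (at (s + d))"
proof -
  have shift: "((\<lambda>t. g (t + e)) has_vector_derivative v) (at r)"
    if "(g has_vector_derivative v) (at (r + e))" for g :: "real \<Rightarrow> 'b" and e r v
  proof -
    have "((\<lambda>t. t + e) has_vector_derivative 1) (at r)"
      by (auto intro!: derivative_eq_intros)
    from vector_diff_chain_at[OF this that] show ?thesis by (simp add: o_def)
  qed
  have "((\<lambda>t. f (t + d)) has_vector_derivative v) (at s) \<longleftrightarrow>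
      (f has_vector_derivative v) (at (s + d))" for v
    using shift[of f v s d] shift[of "\<lambda>t. f (t + d)" v "s + d" "- d"] by auto
  then show ?thesis by (simp add: vector_derivative_def)
qed

lemma smooth_curve_cong:
  assumes "\<And>t. t \<in> {a..b} \<Longrightarrow> \<gamma> t = \<gamma>' t"
  shows "smooth_curve A a b \<gamma> \<longleftrightarrow> smooth_curve A a b \<gamma>'"
proof -
  have "{t \<in> {a..b}. \<gamma> t \<in> fst c} = {t \<in> {a..b}. \<gamma>' t \<in> fst c}" for c :: "('a, 'b) chart"
    using assms by auto
  then have "smooth_on {t \<in> {a..b}. \<gamma> t \<in> fst c} (snd c \<circ> \<gamma>) \<longleftrightarrow>
      smooth_on {t \<in> {a..b}. \<gamma>' t \<in> fst c} (snd c \<circ> \<gamma>')" for c :: "('a, 'b) chart"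
    by (rule smooth_on_cong) (use assms in auto)
  moreover have "continuous_on {a..b} \<gamma> \<longleftrightarrow> continuous_on {a..b} \<gamma>'"
    using assms by (rule continuous_on_cong[OF refl])
  ultimately show ?thesis by (simp add: smooth_curve_def)
qed

lemma smooth_curve_shift:
  assumes "smooth_curve A a b \<gamma>"
  shows "smooth_curve A (a - d) (b - d) (\<lambda>t. \<gamma> (t + d))"
  unfolding smooth_curve_def
proof (intro conjI ballI)
  show "continuous_on {a - d..b - d} (\<lambda>t. \<gamma> (t + d))"
    by (rule continuous_on_compose2[of "{a..b}" \<gamma>])
      (use assms in \<open>auto simp: smooth_curve_def intro!: continuous_intros\<close>)
  fix c assume "c \<in> A"
  then have "smooth_on {t \<in> {a..b}. \<gamma> t \<in> fst c} (snd c \<circ> \<gamma>)"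
    using assms by (simp add: smooth_curve_def)
  then have "smooth_on {t \<in> {a - d..b - d}. \<gamma> (t + d) \<in> fst c} ((snd c \<circ> \<gamma>) \<circ> (\<lambda>t. d + t *\<^sub>R 1))"
    by (rule smooth_on_affine) (auto simp: add.commute)
  then show "smooth_on {t \<in> {a - d..b - d}. \<gamma> (t + d) \<in> fst c} (snd c \<circ> (\<lambda>t. \<gamma> (t + d)))"
    by (simp add: o_def add.commute)
qed

lemma piecewise_smooth_curve_refl: "piecewise_smooth_curve A a a \<gamma>"
  unfolding piecewise_smooth_curve_def by (intro exI[of _ 0] exI[of _ "\<lambda>_. a"]) simp

lemma piecewise_smooth_curve_snoc:
  assumes "piecewise_smooth_curve A a b \<gamma>" "b < c" "smooth_curve A b c \<gamma>"
  shows "piecewise_smooth_curve A a c \<gamma>"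
proof -
  obtain n \<tau> where "\<tau> 0 = a" "\<tau> n = b"
    "\<forall>i<n. \<tau> i < \<tau> (Suc i) \<and> smooth_curve A (\<tau> i) (\<tau> (Suc i)) \<gamma>"
    using assms(1) unfolding piecewise_smooth_curve_def by blast
  with assms(2,3) show ?thesis
    unfolding piecewise_smooth_curve_def
    by (intro exI[of _ "Suc n"] exI[of _ "\<tau>(Suc n := c)"]) (auto simp: less_Suc_eq)
qed

lemma smooth_imp_piecewise:
  "a < b \<Longrightarrow> smooth_curve A a b \<gamma> \<Longrightarrow> piecewise_smooth_curve A a b \<gamma>"
  by (rule piecewise_smooth_curve_snoc[OF piecewise_smooth_curve_refl])

text \<open>The curve and its starting time stay fixed while the end time advances by one smooth
  piece.\<close>

lemma piecewise_smooth_curve_induct [consumes 1, case_names refl snoc]: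
  assumes "piecewise_smooth_curve A a b \<gamma>"
    and "P a"
    and step: "\<And>b c. piecewise_smooth_curve A a b \<gamma> \<Longrightarrow> P b \<Longrightarrow> a \<le> b \<Longrightarrow> b < c \<Longrightarrow>
      smooth_curve A b c \<gamma> \<Longrightarrow> P c"
  shows "P b"
proof -
  obtain n \<tau> where \<tau>: "\<tau> 0 = a" "\<tau> n = b"
    "\<And>i. i < n \<Longrightarrow> \<tau> i < \<tau> (Suc i) \<and> smooth_curve A (\<tau> i) (\<tau> (Suc i)) \<gamma>"
    using assms(1) unfolding piecewise_smooth_curve_def by blast
  have "i \<le> n \<Longrightarrow> piecewise_smooth_curve A a (\<tau> i) \<gamma> \<and> P (\<tau> i) \<and> a \<le> \<tau> i" for i
  proof (induction i)
    case 0
    then show ?case using \<tau>(1) assms(2) piecewise_smooth_curve_refl by simp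
  next
    case (Suc i)
    then have IH: "piecewise_smooth_curve A a (\<tau> i) \<gamma>" "P (\<tau> i)" "a \<le> \<tau> i"
      and *: "\<tau> i < \<tau> (Suc i)" "smooth_curve A (\<tau> i) (\<tau> (Suc i)) \<gamma>" using \<tau>(3)[of i] by auto
    with piecewise_smooth_curve_snoc[OF IH(1) *] step[OF IH *] show ?case by auto
  qed
  with \<tau>(2) show ?thesis by blast
qed

lemma piecewise_smooth_curve_cong:
  assumes "piecewise_smooth_curve A a b \<gamma>" "\<And>t. t \<in> {a..b} \<Longrightarrow> \<gamma>' t = \<gamma> t"
  shows "piecewise_smooth_curve A a b \<gamma>'"
  using assms
proof (induction rule: piecewise_smooth_curve_induct)
  case refl
  show ?case by (rule piecewise_smooth_curve_refl)
next
  case (snoc b c)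
  then have "smooth_curve A b c \<gamma>'" using smooth_curve_cong[of b c \<gamma>' \<gamma> A] by auto
  moreover have "piecewise_smooth_curve A a b \<gamma>'" using snoc by auto
  ultimately show ?case using piecewise_smooth_curve_snoc snoc by blast
qed

lemma piecewise_smooth_curve_shift:
  assumes "piecewise_smooth_curve A a b \<gamma>"
  shows "piecewise_smooth_curve A (a - d) (b - d) (\<lambda>t. \<gamma> (t + d))"
  using assms
proof (induction rule: piecewise_smooth_curve_induct)
  case refl
  show ?case by (rule piecewise_smooth_curve_refl)
next
  case (snoc b c)
  then show ?case
    using piecewise_smooth_curve_snoc smooth_curve_shift[of A b c \<gamma> d] by fastforce
qed

lemma piecewise_smooth_curve_trans:
  assumes "piecewise_smooth_curve A b c \<gamma>" "piecewise_smooth_curve A a b \<gamma>"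
  shows "piecewise_smooth_curve A a c \<gamma>"
  using assms
proof (induction rule: piecewise_smooth_curve_induct)
  case (snoc c' c)
  then show ?case using piecewise_smooth_curve_snoc by blast
qed

section \<open>Additivity of the length\<close>

context finsler_manifold
begin

text \<open>Unlike \<^const>\<open>velocity\<close>, the two-sided derivative does not depend on the parameter interval,
  so the length integral becomes additive under concatenation.\<close>

definition speed :: "(real \<Rightarrow> 'a) \<Rightarrow> real \<Rightarrow> real" where
  "speed \<gamma> s = F (\<gamma> s, \<lambda>c. if c \<in> A \<and> \<gamma> s \<in> fst c
     then vector_derivative (snd c \<circ> \<gamma>) (at s) else 0)"

lemma speed_eq:
  assumes "a < s" "s < b"
  shows "speed \<gamma> s = F (\<gamma> s, velocity A a b \<gamma> s)"
  by (simp only: speed_def velocity_def at_within_Icc_at[OF assms])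

text \<open>The one-sided and the two-sided derivative can differ only at the end points, a null
  set.\<close>

lemma finsler_length_eq: "finsler_length A F a b \<gamma> = integral {a..b} (speed \<gamma>)"
  unfolding finsler_length_def
  by (rule integral_spike[of "{a, b}"]) (auto intro!: speed_eq)

lemma speed_cong:
  assumes "open T" "s \<in> T" "\<And>t. t \<in> T \<Longrightarrow> \<gamma> t = \<gamma>' t"
  shows "speed \<gamma> s = speed \<gamma>' s"
proof -
  have ev: "\<forall>\<^sub>F t in nhds s. \<gamma> t = \<gamma>' t"
    using assms by (auto simp: eventually_nhds)
  have "vector_derivative (snd c \<circ> \<gamma>) (at s) = vector_derivative (snd c \<circ> \<gamma>') (at s)" for c :: "('a, 'e) chart"
    by (rule vector_derivative_cong_eq) (use ev in \<open>auto elim!: eventually_mono\<close>)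
  with assms show ?thesis by (simp add: speed_def cong: if_cong)
qed

lemma speed_shift: "speed (\<lambda>t. \<gamma> (t + d)) s = speed \<gamma> (s + d)"
  using vector_derivative_shift[of "snd c \<circ> \<gamma>" d s for c :: "('a, 'e) chart"]
  by (simp add: speed_def o_def cong: if_cong)

text \<open>The end points are negligible, so the derivative of a glued curve at the junction does
  not affect its length.\<close>

lemma integral_speed_cong:
  assumes "\<And>t. t \<in> {a<..<b} \<Longrightarrow> \<gamma> t = \<gamma>' t"
  shows "integral {a..b} (speed \<gamma>) = integral {a..b} (speed \<gamma>')"
  by (rule integral_spike[of "{a, b}"])
    (use assms in \<open>auto intro!: speed_cong[of "{a<..<b}"]\<close>)

lemma integrable_speed_smooth:
  assumes "smooth_curve A a b \<gamma>" "a < b"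
  shows "speed \<gamma> integrable_on {a..b}"
  by (rule integrable_spike_finite[of "{a, b}"])
    (use integrable_continuous_real[OF continuous_on_F_velocity[OF assms]] in \<open>auto intro!: speed_eq\<close>)

lemma integral_speed_smooth_nonneg:
  assumes "smooth_curve A a b \<gamma>" "a < b"
  shows "0 \<le> integral {a..b} (speed \<gamma>)"
  unfolding finsler_length_eq[symmetric] finsler_length_def
  using integrable_continuous_real[OF continuous_on_F_velocity[OF assms]] F_velocity_nonneg[OF assms]
  by (rule integral_nonneg)

text \<open>Increments of the potential \<open>\<rho>\<close> telescope over the pieces;
  integrability is carried along because splitting the integral requires it. A constant potential
  gives nonnegative length, a truncated coordinate distance gives a lower bound.\<close>

lemma piecewise_length_bound:
  assumes "piecewise_smooth_curve A a b \<gamma>"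
    and "\<And>a b. a < b \<Longrightarrow> smooth_curve A a b \<gamma> \<Longrightarrow> \<rho> (\<gamma> b) - \<rho> (\<gamma> a) \<le> integral {a..b} (speed \<gamma>)"
  shows "speed \<gamma> integrable_on {a..b} \<and> \<rho> (\<gamma> b) - \<rho> (\<gamma> a) \<le> integral {a..b} (speed \<gamma>)"
  using assms
proof (induction rule: piecewise_smooth_curve_induct)
  case (snoc b c)
  have "speed \<gamma> integrable_on {a..c}"
    using Henstock_Kurzweil_Integration.integrable_combine[of a b c "speed \<gamma>"] integrable_speed_smooth snoc by simp
  moreover from this have "integral {a..b} (speed \<gamma>) + integral {b..c} (speed \<gamma>) = integral {a..c} (speed \<gamma>)"
    using snoc by (intro Henstock_Kurzweil_Integration.integral_combine) auto
  ultimately show ?case using snoc by fastforce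
qed (use integrable_on_refl[of "speed \<gamma>" a] in simp)

lemma integrable_speed: "piecewise_smooth_curve A a b \<gamma> \<Longrightarrow> speed \<gamma> integrable_on {a..b}"
  and integral_speed_nonneg: "piecewise_smooth_curve A a b \<gamma> \<Longrightarrow> 0 \<le> integral {a..b} (speed \<gamma>)"
  using piecewise_length_bound[of a b \<gamma> "\<lambda>_. 0"] integral_speed_smooth_nonneg by auto

section \<open>Lengths of curves between two points\<close>

definition curve_lengths :: "'a \<Rightarrow> 'a \<Rightarrow> real set" where
  "curve_lengths p q = {integral {a..b} (speed \<gamma>) | a b \<gamma>.
     a < b \<and> piecewise_smooth_curve A a b \<gamma> \<and> \<gamma> a = p \<and> \<gamma> b = q}"

lemma finsler_dist_eq: "finsler_dist A F p q = Inf (curve_lengths p q)"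
  by (simp add: finsler_dist_def curve_lengths_def finsler_length_eq)

lemma curve_lengths_nonneg: "L \<in> curve_lengths p q \<Longrightarrow> 0 \<le> L"
  using integral_speed_nonneg by (auto simp: curve_lengths_def)

lemma bdd_below_curve_lengths: "bdd_below (curve_lengths p q)"
  using curve_lengths_nonneg by (meson bdd_belowI)

text \<open>Concatenation: the second curve is shifted in time to begin when the first one ends, and
  the integrals of \<open>speed\<close> add up.\<close>

lemma curve_lengths_add:
  assumes "L1 \<in> curve_lengths p q" "L2 \<in> curve_lengths q r"
  shows "L1 + L2 \<in> curve_lengths p r"
proof -
  obtain a b \<gamma>1 where 1: "L1 = integral {a..b} (speed \<gamma>1)" "a < b"
    "piecewise_smooth_curve A a b \<gamma>1" "\<gamma>1 a = p" "\<gamma>1 b = q"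
    using assms(1) by (auto simp: curve_lengths_def)
  obtain b' c' \<gamma>' where 2: "L2 = integral {b'..c'} (speed \<gamma>')" "b' < c'"
    "piecewise_smooth_curve A b' c' \<gamma>'" "\<gamma>' b' = q" "\<gamma>' c' = r"
    using assms(2) by (auto simp: curve_lengths_def)
  define d where "d = b' - b"
  define c where "c = c' - d"
  define \<gamma>2 where "\<gamma>2 = (\<lambda>t. \<gamma>' (t + d))"
  have "b < c" using 2(2) by (simp add: c_def d_def)
  have \<gamma>2: "piecewise_smooth_curve A b c \<gamma>2" "\<gamma>2 b = q" "\<gamma>2 c = r"
    using piecewise_smooth_curve_shift[OF 2(3), of d] 2 by (simp_all add: \<gamma>2_def c_def d_def)
  have L2: "L2 = integral {b..c} (speed \<gamma>2)"
  proof -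
    have "speed \<gamma>2 = (\<lambda>t. speed \<gamma>' (t + d))"
      by (simp add: fun_eq_iff \<gamma>2_def speed_shift)
    then show ?thesis
      using integral_shift_real_ivl[of b' d c' "speed \<gamma>'"] 2(1) by (simp add: c_def d_def)
  qed
  \<comment> \<open>At time \<open>b\<close> both branches have the value \<open>q\<close>, so the
    glued curve agrees with each piece on its closed interval.\<close>
  define \<gamma> where "\<gamma> = (\<lambda>t. if t \<le> b then \<gamma>1 t else \<gamma>2 t)"
  have "piecewise_smooth_curve A a b \<gamma>"
    using 1(3) by (rule piecewise_smooth_curve_cong) (simp add: \<gamma>_def)
  moreover have "piecewise_smooth_curve A b c \<gamma>"
    using \<gamma>2(1) by (rule piecewise_smooth_curve_cong) (use 1(5) \<gamma>2(2) in \<open>auto simp: \<gamma>_def\<close>)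
  ultimately have pw: "piecewise_smooth_curve A a c \<gamma>"
    by (rule piecewise_smooth_curve_trans[rotated])
  have "integral {a..b} (speed \<gamma>) = L1" "integral {b..c} (speed \<gamma>) = L2"
    unfolding 1(1) L2 by (rule integral_speed_cong; simp add: \<gamma>_def)+
  then have "integral {a..c} (speed \<gamma>) = L1 + L2"
    using Henstock_Kurzweil_Integration.integral_combine[OF _ _ integrable_speed[OF pw], of b] 1(2) \<open>b < c\<close> by simp
  moreover have "\<gamma> a = p" "\<gamma> c = r" "a < c"
    using 1 \<gamma>2(3) \<open>b < c\<close> by (auto simp: \<gamma>_def)
  ultimately show ?thesis
    unfolding curve_lengths_def using pw by (intro CollectI exI[of _ a] exI[of _ c] exI[of _ \<gamma>]) simp
qed

text \<open>By convexity the coordinate segment stays in \<open>K\<close>, and its coordinate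
  velocity is constantly \<open>y - x\<close>, so a constant bounds the integrand over the unit
  interval.\<close>

lemma segment_length:
  assumes c: "c \<in> A" and K: "convex K" "K \<subseteq> snd c ` fst c" "x \<in> K" "y \<in> K"
    and C: "\<And>z u. z \<in> K \<Longrightarrow> coord_F c z u \<le> C * norm u"
  shows "\<exists>L \<in> curve_lengths (chart_inv c x) (chart_inv c y). L \<le> C * norm (y - x)"
proof -
  define l where "l = (\<lambda>t::real. x + t *\<^sub>R (y - x))"
  define \<gamma> where "\<gamma> = chart_inv c \<circ> l"
  have lK: "l t \<in> K" if "t \<in> {0..1}" for t
    using convexD_alt[OF K(1) K(3) K(4), of t] that by (simp add: l_def algebra_simps)
  have l_in: "l t \<in> snd c ` fst c" if "t \<in> {0..1}" for t using lK[OF that] K(2) by blast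
  have sm: "smooth_curve A 0 1 \<gamma>"
    unfolding smooth_curve_def
  proof (intro conjI ballI)
    show "continuous_on {0..1} \<gamma>"
      unfolding \<gamma>_def l_def o_def
      by (rule continuous_on_compose2[OF continuous_on_chart_inv[OF c]])
        (use l_in in \<open>auto simp: l_def intro!: continuous_intros\<close>)
    fix c' assume c': "c' \<in> A"
    have "l t \<in> snd c ` (fst c \<inter> fst c')" if "t \<in> {0..1}" "\<gamma> t \<in> fst c'" for t
    proof -
      from l_in[OF that(1)] obtain p where p: "p \<in> fst c" "l t = snd c p" by blast
      then have "\<gamma> t = p" using c by (simp add: \<gamma>_def)
      with p that(2) show ?thesis by simp
    qed
    then have "smooth_on {t \<in> {0..1}. \<gamma> t \<in> fst c'} ((snd c' \<circ> chart_inv c) \<circ> (\<lambda>t. x + t *\<^sub>R (y - x)))"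
      by (intro smooth_on_affine[OF compatible[OF c c']]) (auto simp: l_def)
    then show "smooth_on {t \<in> {0..1}. \<gamma> t \<in> fst c'} (snd c' \<circ> \<gamma>)"
      by (simp add: \<gamma>_def l_def o_assoc)
  qed
  have bound: "F (\<gamma> t, velocity A 0 1 \<gamma> t) \<le> C * norm (y - x)" if t: "t \<in> {0..1}" for t
  proof -
    have in_c: "\<gamma> t \<in> fst c" and eq: "snd c (\<gamma> t) = l t"
      using l_in[OF t] c by (simp_all add: \<gamma>_def)
    have "(l has_vector_derivative y - x) (at t within {0..1})"
      unfolding l_def by (auto intro!: derivative_eq_intros)
    then have "(snd c \<circ> \<gamma> has_vector_derivative y - x) (at t within {0..1})"
      by (rule has_vector_derivative_transform[rotated 2])
        (use t l_in c in \<open>auto simp: \<gamma>_def\<close>)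
    then have "velocity A 0 1 \<gamma> t c = y - x"
      using velocity_unique t c in_c by simp
    with F_velocity[OF sm _ t c in_c] C[OF lK[OF t]] eq show ?thesis by simp
  qed
  have "integral {0..1} (speed \<gamma>) \<le> integral {0..1::real} (\<lambda>_. C * norm (y - x))"
    unfolding finsler_length_eq[symmetric] finsler_length_def
    using integrable_continuous_real[OF continuous_on_F_velocity[OF sm]] bound
    by (intro integral_le) auto
  then have "integral {0..1} (speed \<gamma>) \<le> C * norm (y - x)" by simp
  moreover have "\<gamma> 0 = chart_inv c x" "\<gamma> 1 = chart_inv c y" by (simp_all add: \<gamma>_def l_def)
  then have "integral {0..1} (speed \<gamma>) \<in> curve_lengths (chart_inv c x) (chart_inv c y)"
    unfolding curve_lengths_def using smooth_imp_piecewise[OF zero_less_one sm] zero_less_one by blast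
  ultimately show ?thesis by blast
qed

end

section \<open>The distance\<close>

context finsler_manifold
begin

text \<open>Coordinate segments to nearby points are short. The claim is about existing curves,
  since an infimum over an empty set would say nothing and nonemptiness is derived from it. Both
  directions appear because \<open>F\<close> may be irreversible.\<close>

lemma short_curves_nearby:
  assumes "0 < e"
  shows "\<forall>\<^sub>F q in nhds p. (\<exists>L \<in> curve_lengths p q. L < e) \<and> (\<exists>L \<in> curve_lengths q p. L < e)"
proof -
  obtain c where c: "c \<in> A" "p \<in> fst c" using obtain_chart .
  let ?x = "snd c p"
  obtain r where r: "0 < r" "cball ?x r \<subseteq> snd c ` fst c"
    using open_image[OF c(1)] c(2) by (meson image_eqI open_contains_cball)
  obtain m C where C: "0 \<le> C" "\<And>x u. x \<in> cball ?x r \<Longrightarrow> coord_F c x u \<le> C * norm u"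
    using coord_F_bounds[OF c(1) compact_cball r(2)] by metis
  \<comment> \<open>The bound \<open>r\<close> keeps the segments in the coordinate ball; dividing
    by \<open>C + 1\<close> makes \<open>C * \<delta>\<close> strictly smaller than
    \<open>e\<close>, also for \<open>C = 0\<close>.\<close>
  define \<delta> where "\<delta> = min r (e / (C + 1))"
  have "0 < \<delta>" using r(1) C(1) assms by (simp add: \<delta>_def)
  have sub: "ball ?x \<delta> \<subseteq> cball ?x r" by (auto simp: \<delta>_def)
  let ?U = "chart_inv c ` ball ?x \<delta>"
  have "open ?U" using sub r(2) by (intro chart_inv_image_open[OF c(1)]) auto
  moreover have "p \<in> ?U" using c \<open>0 < \<delta>\<close> by (metis centre_in_ball chart_inv_chart image_eqI)
  moreover have "(\<exists>L \<in> curve_lengths p q. L < e) \<and> (\<exists>L \<in> curve_lengths q p. L < e)" if q: "q \<in> ?U" for q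
  proof -
    obtain y where y: "y \<in> ball ?x \<delta>" "q = chart_inv c y" using q by blast
    have "norm (y - ?x) < \<delta>" using y(1) by (simp add: dist_norm norm_minus_commute)
    then have "C * norm (y - ?x) \<le> C * (e / (C + 1))"
      using C(1) by (intro mult_left_mono) (auto simp: \<delta>_def)
    also have "\<dots> < e" using C(1) assms by (simp add: field_simps)
    finally have less: "C * norm (y - ?x) < e" .
    have yK: "y \<in> cball ?x r" and xK: "?x \<in> cball ?x r" using y(1) sub r(1) by auto
    have "\<exists>L \<in> curve_lengths (chart_inv c ?x) (chart_inv c y). L \<le> C * norm (y - ?x)"
      by (rule segment_length[OF c(1) convex_cball r(2) xK yK C(2)])
    moreover have "\<exists>L \<in> curve_lengths (chart_inv c y) (chart_inv c ?x). L \<le> C * norm (?x - y)"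
      by (rule segment_length[OF c(1) convex_cball r(2) yK xK C(2)])
    ultimately show ?thesis
      using less c y(2) by (metis chart_inv_chart norm_minus_commute order_le_less_trans)
  qed
  ultimately show ?thesis unfolding eventually_nhds by blast
qed

text \<open>The set \<open>R\<close> of points reachable from \<open>p\<close> is open, closed and
  nonempty, so connectedness makes it everything.\<close>

lemma curve_lengths_nonempty: "curve_lengths p q \<noteq> {}"
proof -
  define R where "R = {q. curve_lengths p q \<noteq> {}}"
  \<comment> \<open>Short curves run both to and from \<open>z\<close>, so reachability is constant
    near each point.\<close>
  have near: "\<exists>T. open T \<and> z \<in> T \<and> (\<forall>q\<in>T. q \<in> R \<longleftrightarrow> z \<in> R)" for z
  proof -
    obtain T where T: "open T" "z \<in> T"
      "\<And>q. q \<in> T \<Longrightarrow> curve_lengths z q \<noteq> {} \<and> curve_lengths q z \<noteq> {}"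
      using short_curves_nearby[OF zero_less_one, of z] unfolding eventually_nhds by blast
    have "q \<in> R \<longleftrightarrow> z \<in> R" if "q \<in> T" for q
      using T(3)[OF that] curve_lengths_add[of _ p q _ z] curve_lengths_add[of _ p z _ q]
      unfolding R_def by blast
    with T(1,2) show ?thesis by blast
  qed
  have "open R"
  proof (rule topological_space_class.openI)
    fix z assume "z \<in> R"
    with near[of z] show "\<exists>T. open T \<and> z \<in> T \<and> T \<subseteq> R" by (metis subsetI)
  qed
  moreover have "open (- R)"
  proof (rule topological_space_class.openI)
    fix z assume "z \<in> - R"
    with near[of z] show "\<exists>T. open T \<and> z \<in> T \<and> T \<subseteq> - R" by (metis ComplD ComplI subsetI)
  qed
  moreover have "p \<in> R"
    using eventually_nhds_x_imp_x[OF short_curves_nearby[OF zero_less_one, of p]]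
    unfolding R_def by blast
  ultimately have "R = UNIV" using connectedD[OF connected, of R "- R"] by auto
  then show ?thesis unfolding R_def by blast
qed

section \<open>Basic inequalities for the asymmetric distance\<close>

lemma finsler_dist_le: "L \<in> curve_lengths p q \<Longrightarrow> finsler_dist A F p q \<le> L"
  unfolding finsler_dist_eq using bdd_below_curve_lengths by (rule cInf_lower[rotated])

lemma finsler_dist_greatest:
  "(\<And>L. L \<in> curve_lengths p q \<Longrightarrow> x \<le> L) \<Longrightarrow> x \<le> finsler_dist A F p q"
  unfolding finsler_dist_eq using curve_lengths_nonempty by (rule cInf_greatest)

lemma finsler_dist_nonneg: "0 \<le> finsler_dist A F p q"
  using curve_lengths_nonneg by (rule finsler_dist_greatest)

text \<open>The infimum is taken first over curves from \<open>q\<close> to \<open>r\<close>, then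
  over curves from \<open>p\<close> to \<open>q\<close>.\<close>

lemma finsler_dist_triangle:
  "finsler_dist A F p r \<le> finsler_dist A F p q + finsler_dist A F q r"
proof -
  have "finsler_dist A F p r - L1 \<le> finsler_dist A F q r" if "L1 \<in> curve_lengths p q" for L1
    using finsler_dist_le[OF curve_lengths_add[OF that]]
    by (intro finsler_dist_greatest) (simp add: algebra_simps)
  then have "finsler_dist A F p r - finsler_dist A F q r \<le> finsler_dist A F p q"
    by (intro finsler_dist_greatest) (simp add: algebra_simps)
  then show ?thesis by simp
qed

lemma finsler_dist_nearby:
  assumes "0 < e"
  shows "\<forall>\<^sub>F q in nhds p. finsler_dist A F p q < e \<and> finsler_dist A F q p < e"
  using short_curves_nearby[OF assms, of p]
  by eventually_elim (meson finsler_dist_le order_le_less_trans)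

lemma finsler_dist_refl: "finsler_dist A F p p = 0"
proof -
  have "finsler_dist A F p p \<le> e" if "0 < e" for e
    using eventually_nhds_x_imp_x[OF finsler_dist_nearby[OF that, of p]] by simp
  then have "finsler_dist A F p p \<le> 0" by (rule field_le_epsilon) simp
  with finsler_dist_nonneg[of p p] show ?thesis by simp
qed

section \<open>Separation of points\<close>

text \<open>Truncating \<open>\<rho>\<close> at \<open>r\<close> makes the estimate telescope over the pieces of a curve.  On one piece
  it suffices to integrate up to the first exit time from the ball.\<close>

lemma chart_escape_length:
  fixes r :: real
  assumes c: "c \<in> A" and r: "cball x r \<subseteq> snd c ` fst c" and m: "0 < m"
    and bound: "\<And>z u. z \<in> cball x r \<Longrightarrow> m * norm u \<le> coord_F c z u"
    and sm: "smooth_curve A a b \<gamma>" and "a < b"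
  defines "\<rho> \<equiv> \<lambda>z. if z \<in> chart_inv c ` ball x r then dist x (snd c z) else r"
  shows "m * (\<rho> (\<gamma> b) - \<rho> (\<gamma> a)) \<le> integral {a..b} (speed \<gamma>)"
proof (cases "\<rho> (\<gamma> b) \<le> \<rho> (\<gamma> a)")
  case True
  then have "m * (\<rho> (\<gamma> b) - \<rho> (\<gamma> a)) \<le> 0" using m by (intro mult_nonneg_nonpos) auto
  then show ?thesis using integral_speed_smooth_nonneg[OF sm \<open>a < b\<close>] by linarith
next
  case False
  let ?U = "chart_inv c ` ball x r" and ?K = "chart_inv c ` cball x r"
  let ?h = "\<lambda>s. F (\<gamma> s, velocity A a b \<gamma> s)"
  have ball_sub: "ball x r \<subseteq> snd c ` fst c" using r ball_subset_cball by blast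
  have openU: "open ?U" by (rule chart_inv_image_open[OF c open_ball ball_sub])
  \<comment> \<open>Compact sets are closed because the manifold is Hausdorff.\<close>
  have closedK: "closed ?K"
    using continuous_on_subset[OF continuous_on_chart_inv[OF c] r]
    by (intro compact_imp_closed compact_continuous_image compact_cball)
  have \<rho>_le: "\<rho> z \<le> r" for z
    using ball_sub c by (auto simp: \<rho>_def subset_iff)
  \<comment> \<open>On the bounding sphere both branches of \<open>\<rho>\<close> give
    \<open>r\<close>, so the formula extends to the closed ball.\<close>
  have \<rho>_K: "\<rho> z = dist x (snd c z)" if "z \<in> ?K" for z
  proof -
    obtain y where y: "y \<in> cball x r" "z = chart_inv c y" using \<open>z \<in> ?K\<close> by blast
    then have eq: "snd c z = y" using r c by (metis chart_chart_inv subsetD)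
    show ?thesis
    proof (cases "z \<in> ?U")
      case False
      then have "y \<notin> ball x r" using y(2) by blast
      with y(1) False eq show ?thesis by (simp add: \<rho>_def)
    qed (simp add: \<rho>_def)
  qed
  have K_c: "?K \<subseteq> fst c" using r c by (auto simp: subset_iff)
  have cont: "continuous_on {a..b} \<gamma>" using sm by (simp add: smooth_curve_def)
  have inU: "\<gamma> a \<in> ?U" using False \<rho>_le[of "\<gamma> b"] by (auto simp: \<rho>_def split: if_splits)

  \<comment> \<open>Times outside the open ball, together with \<open>b\<close> so that a minimum
    exists: the first exit time, or \<open>b\<close> if the curve stays inside.\<close>
  let ?E = "({a..b} \<inter> \<gamma> -` (- ?U)) \<union> {b}"
  have "closed ({a..b} \<inter> \<gamma> -` (- ?U))"
    by (rule continuous_closed_preimage[OF cont]) (use openU in auto)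
  moreover have "?E \<subseteq> {a..b}" using \<open>a < b\<close> by auto
  ultimately have "compact ?E"
    using compact_Int_closed[OF compact_Icc, of "{a..b} \<inter> \<gamma> -` (- ?U)" a b] by (auto simp: Int_absorb1)
  then obtain t where t: "t \<in> ?E" "\<And>s. s \<in> ?E \<Longrightarrow> t \<le> s"
    using compact_attains_inf[of ?E] by blast
  have "a < t" using t(1) inU \<open>a < b\<close> by (cases "t = a") auto
  have "t \<le> b" using t(1) by auto
  have before: "\<gamma> s \<in> ?U" if "a \<le> s" "s < t" for s
    using t(2)[of s] that \<open>t \<le> b\<close> by force
  \<comment> \<open>At time \<open>t\<close> the curve may lie on the boundary; that point is a
    limit of earlier points in the closed set \<open>?K\<close>.\<close>
  have inK: "\<gamma> s \<in> ?K" if "s \<in> {a..t}" for s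
  proof -
    have "\<gamma> ` closure {a..<t} \<subseteq> ?K"
    proof (rule image_closure_subset[OF _ closedK])
      show "continuous_on (closure {a..<t}) \<gamma>"
        using \<open>a < t\<close> \<open>t \<le> b\<close> by (auto intro: continuous_on_subset[OF cont])
      show "\<gamma> ` {a..<t} \<subseteq> ?K" using before ball_subset_cball by fastforce
    qed
    then show ?thesis using that \<open>a < t\<close> by auto
  qed
  \<comment> \<open>Either \<open>t = b\<close>, or the curve is outside the open ball at
    \<open>t\<close>, where \<open>\<rho>\<close> has its maximal value \<open>r\<close>.\<close>
  have \<rho>_t: "\<rho> (\<gamma> b) \<le> \<rho> (\<gamma> t)"
    using t(1) \<rho>_le[of "\<gamma> b"] by (auto simp: \<rho>_def)

  have h_int: "?h integrable_on {a..b}"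
    by (rule integrable_continuous_real[OF continuous_on_F_velocity[OF sm \<open>a < b\<close>]])
  \<comment> \<open>Mean value inequality: up to time \<open>t\<close> the lower bound on
    \<open>coord_F\<close> makes the coordinate speed at most the Finsler speed divided by
    \<open>m\<close>.\<close>
  have "norm ((snd c \<circ> \<gamma>) t - (snd c \<circ> \<gamma>) a) \<le> integral {a..t} ?h / m - integral {a..a} ?h / m"
  proof (rule differentiable_bound_general[OF \<open>a < t\<close>])
    show "continuous_on {a..t} (snd c \<circ> \<gamma>)"
      unfolding o_def
      by (rule continuous_on_compose2[OF continuous_on_chart[OF c]])
        (use inK K_c \<open>t \<le> b\<close> in \<open>auto intro: continuous_on_subset[OF cont]\<close>)
    show "continuous_on {a..t} (\<lambda>s. integral {a..s} ?h / m)"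
      using m \<open>t \<le> b\<close> by (intro continuous_intros indefinite_integral_continuous_1
          integrable_on_subinterval[OF h_int]) auto
    fix s assume s: "a < s" "s < t"
    then have at: "at s within {a..b} = at s" and sab: "s \<in> {a..b}" and sK: "\<gamma> s \<in> ?K"
      using \<open>t \<le> b\<close> inK by (auto intro: at_within_Icc_at)
    have sc: "\<gamma> s \<in> fst c" using sK K_c by blast
    show "(snd c \<circ> \<gamma> has_vector_derivative velocity A a b \<gamma> s c) (at s)"
      using velocity_has_vector_derivative[OF sm \<open>a < b\<close> c sab sc] unfolding at .
    have "((\<lambda>u. integral {a..u} ?h) has_vector_derivative ?h s) (at s within {a..b})"
      by (rule integral_has_vector_derivative[OF continuous_on_F_velocity[OF sm \<open>a < b\<close>] sab])
    then show "((\<lambda>u. integral {a..u} ?h / m) has_vector_derivative ?h s / m) (at s)"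
      unfolding at has_real_derivative_iff_has_vector_derivative[symmetric]
      by (rule DERIV_cdivide)
    have "snd c (\<gamma> s) \<in> cball x r" using sK r c by (auto simp: subset_iff)
    from bound[OF this, of "velocity A a b \<gamma> s c"] F_velocity[OF sm \<open>a < b\<close> sab c sc]
    show "norm (velocity A a b \<gamma> s c) \<le> ?h s / m" using m by (simp add: field_simps)
  qed
  then have "m * norm (snd c (\<gamma> t) - snd c (\<gamma> a)) \<le> integral {a..t} ?h"
    using m by (simp add: field_simps)
  also have "\<dots> \<le> integral {a..b} ?h"
    using \<open>t \<le> b\<close> F_velocity_nonneg[OF sm \<open>a < b\<close>]
    by (intro integral_subset_le integrable_on_subinterval[OF h_int] h_int) auto
  also have "\<dots> = integral {a..b} (speed \<gamma>)"
    unfolding finsler_length_eq[symmetric] finsler_length_def ..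
  finally have len: "m * norm (snd c (\<gamma> t) - snd c (\<gamma> a)) \<le> integral {a..b} (speed \<gamma>)" .
  have "\<rho> (\<gamma> b) - \<rho> (\<gamma> a) \<le> dist x (snd c (\<gamma> t)) - dist x (snd c (\<gamma> a))"
    using \<rho>_t \<rho>_K[OF inK[of t]] \<rho>_K[OF inK[of a]] \<open>a < t\<close> by simp
  also have "\<dots> \<le> norm (snd c (\<gamma> t) - snd c (\<gamma> a))"
    using dist_triangle[of x "snd c (\<gamma> t)" "snd c (\<gamma> a)"]
    by (simp add: dist_norm norm_minus_commute)
  finally have "m * (\<rho> (\<gamma> b) - \<rho> (\<gamma> a)) \<le> m * norm (snd c (\<gamma> t) - snd c (\<gamma> a))"
    using m by (intro mult_left_mono) auto
  with len show ?thesis by linarith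
qed

text \<open>Along any curve from \<open>p\<close> to \<open>q\<close> the truncated coordinate
  distance \<open>\<rho>\<close> climbs from 0 to \<open>r\<close>, which costs length at least
  \<open>m * r\<close>, uniformly in the curve.\<close>

lemma finsler_dist_pos:
  assumes "p \<noteq> q"
  shows "0 < finsler_dist A F p q"
proof -
  obtain c where c: "c \<in> A" "p \<in> fst c" using obtain_chart .
  let ?x = "snd c p"
  obtain r0 where r0: "0 < r0" "cball ?x r0 \<subseteq> snd c ` fst c"
    using open_image[OF c(1)] c(2) by (meson image_eqI open_contains_cball)
  \<comment> \<open>If \<open>q\<close> lies in the chart, the radius is reduced until the open ball
    misses \<open>q\<close>; then \<open>\<rho> q = r\<close>.\<close>
  define r where "r = (if q \<in> fst c then min r0 (dist ?x (snd c q)) else r0)"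
  have "?x \<noteq> snd c q" if "q \<in> fst c"
    using that c assms by (metis chart_inv_chart)
  then have "0 < r" using r0(1) by (simp add: r_def)
  have r: "cball ?x r \<subseteq> snd c ` fst c"
    using r0(2) by (rule order_trans[rotated]) (auto simp: r_def split: if_splits)
  define \<rho> where "\<rho> = (\<lambda>z. if z \<in> chart_inv c ` ball ?x r then dist ?x (snd c z) else r)"
  have "q \<notin> chart_inv c ` ball ?x r"
  proof
    assume "q \<in> chart_inv c ` ball ?x r"
    then obtain y where y: "y \<in> ball ?x r" "q = chart_inv c y" by blast
    moreover from y(1) r have "y \<in> snd c ` fst c" by auto
    ultimately have "q \<in> fst c" "snd c q = y" using c(1) by auto
    with y(1) show False by (simp add: r_def)
  qed
  moreover have "p \<in> chart_inv c ` ball ?x r"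
    using c \<open>0 < r\<close> by (metis centre_in_ball chart_inv_chart image_eqI)
  ultimately have \<rho>: "\<rho> q = r" "\<rho> p = 0" by (simp_all add: \<rho>_def)
  obtain m C where m: "0 < m" "\<And>z u. z \<in> cball ?x r \<Longrightarrow> m * norm u \<le> coord_F c z u"
    using coord_F_bounds[OF c(1) compact_cball r] by metis
  have "m * r \<le> L" if L: "L \<in> curve_lengths p q" for L
  proof -
    obtain a b \<gamma> where \<gamma>: "piecewise_smooth_curve A a b \<gamma>" "\<gamma> a = p" "\<gamma> b = q"
      "L = integral {a..b} (speed \<gamma>)"
      using L by (auto simp: curve_lengths_def)
    have "m * \<rho> (\<gamma> t) - m * \<rho> (\<gamma> s) \<le> integral {s..t} (speed \<gamma>)"
      if "s < t" "smooth_curve A s t \<gamma>" for s t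
      using chart_escape_length[OF c(1) r m that(2,1)] by (simp add: \<rho>_def right_diff_distrib)
    from piecewise_length_bound[OF \<gamma>(1), of "\<lambda>z. m * \<rho> z", OF this] \<gamma> \<rho>
    show ?thesis by simp
  qed
  then have "m * r \<le> finsler_dist A F p q" by (rule finsler_dist_greatest)
  with m(1) \<open>0 < r\<close> show ?thesis by (meson mult_pos_pos order_less_le_trans)
qed

text \<open>By the triangle inequality, moving from \<open>q\<close> to \<open>z\<close> changes the
  distances by at most the larger of the two distances between \<open>q\<close> and
  \<open>z\<close>, and both are small near \<open>q\<close>.\<close>

lemma continuous_on_finsler_dist:
  shows "continuous_on UNIV (finsler_dist A F p)" and "continuous_on UNIV (\<lambda>q. finsler_dist A F q p)"
proof -
  have "\<forall>\<^sub>F z in at q. dist (finsler_dist A F p z) (finsler_dist A F p q) < e \<and>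
      dist (finsler_dist A F z p) (finsler_dist A F q p) < e" if "0 < e" for q e
  proof -
    have "\<forall>\<^sub>F z in at q. finsler_dist A F q z < e \<and> finsler_dist A F z q < e"
      using finsler_dist_nearby[OF that, of q] by (simp add: eventually_nhds_conv_at)
    then show ?thesis
    proof eventually_elim
      case (elim z)
      with finsler_dist_triangle[of p z q] finsler_dist_triangle[of p q z]
        finsler_dist_triangle[of z p q] finsler_dist_triangle[of q p z]
      show ?case by (simp add: dist_real_def abs_less_iff)
    qed
  qed
  then show "continuous_on UNIV (finsler_dist A F p)" "continuous_on UNIV (\<lambda>q. finsler_dist A F q p)"
    by (auto simp: continuous_on_def tendsto_iff eventually_conj_iff)
qed

section \<open>Completeness and compactness\<close>

abbreviation (input) "d \<equiv> finsler_dist A F"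
abbreviation (input) "ds \<equiv> sym_dist A F"

lemma continuous_on_sym_dist: "continuous_on UNIV (ds p)"
  unfolding sym_dist_def by (intro continuous_intros continuous_on_finsler_dist) simp

text \<open>Continuity makes the sublevel set a closed superset of the ball. This and its two
  analogues turn membership in closures into inequalities.\<close>

lemma closure_forward_ball: "closure (forward_ball A F p r) \<subseteq> {x. d p x \<le> r}"
  by (rule closure_minimal)
    (auto simp: forward_ball_def intro!: closed_Collect_le continuous_on_finsler_dist continuous_intros)

lemma closure_backward_ball: "closure (backward_ball A F p r) \<subseteq> {x. d x p \<le> r}"
  by (rule closure_minimal)
    (auto simp: backward_ball_def intro!: closed_Collect_le continuous_on_finsler_dist continuous_intros)

lemma closure_sym_ball: "closure (sym_ball A F p r) \<subseteq> {x. ds p x \<le> r}"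
  by (rule closure_minimal)
    (auto simp: sym_ball_def intro!: closed_Collect_le continuous_on_sym_dist continuous_intros)

section \<open>Completeness of the symmetrized distance\<close>

lemma Metric_space_sym_dist: "Metric_space UNIV ds"
proof
  fix x y z
  show "0 \<le> ds x y" "ds x y = ds y x"
    using finsler_dist_nonneg by (simp_all add: sym_dist_def)
  show "ds x y = 0 \<longleftrightarrow> x = y"
    using finsler_dist_pos[of x y] finsler_dist_nonneg[of y x] finsler_dist_refl
    by (cases "x = y") (auto simp: sym_dist_def)
  show "ds x z \<le> ds x y + ds y z"
  proof -
    have "d x z + d z x \<le> (d x y + d y x) + (d y z + d z y)"
      using finsler_dist_triangle[of x z y] finsler_dist_triangle[of z x y] by linarith
    then show ?thesis
      unfolding sym_dist_def add_divide_distrib[symmetric] by (rule divide_right_mono) simp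
  qed
qed

text \<open>Compactness refers to the manifold topology, convergence to \<open>ds\<close>; the link
  is that every \<open>ds\<close>-ball around a point is a neighbourhood of it.\<close>

lemma mcomplete_sym_dist:
  assumes "\<And>x r. 0 < r \<Longrightarrow> compact (closure (sym_ball A F x r))"
  shows "Metric_space.mcomplete UNIV ds"
proof -
  interpret Metric_space UNIV ds by (rule Metric_space_sym_dist)
  show ?thesis
    unfolding mcomplete_def
  proof (intro allI impI)
    fix \<sigma> assume \<sigma>: "MCauchy \<sigma>"
    then have Cauchy: "\<exists>N. \<forall>n n'. N \<le> n \<longrightarrow> N \<le> n' \<longrightarrow> ds (\<sigma> n) (\<sigma> n') < e" if "0 < e" for e
      using that unfolding MCauchy_def by blast
    obtain N where N: "\<And>n n'. N \<le> n \<Longrightarrow> N \<le> n' \<Longrightarrow> ds (\<sigma> n) (\<sigma> n') < 1"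
      using Cauchy[OF zero_less_one] by blast
    let ?K = "closure (sym_ball A F (\<sigma> N) 1)"
    have "\<sigma> n \<in> ?K" if "N \<le> n" for n
      using N[OF order_refl that] by (intro subsetD[OF closure_subset]) (simp add: sym_ball_def)
    then have "\<forall>\<^sub>F n in sequentially. \<sigma> n \<in> ?K"
      unfolding eventually_sequentially by blast
    \<comment> \<open>Compactness in filter form: the image filter of the sequence contains
      \<open>?K\<close>, hence has a cluster point \<open>z\<close>.\<close>
    then have "eventually (\<lambda>x. x \<in> ?K) (filtermap \<sigma> sequentially)"
      by (simp add: eventually_filtermap)
    moreover have "filtermap \<sigma> sequentially \<noteq> bot" by (simp add: filtermap_bot_iff)
    ultimately obtain z where z: "inf (nhds z) (filtermap \<sigma> sequentially) \<noteq> bot"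
      using assms[of 1 "\<sigma> N"] unfolding compact_filter by auto
    have "\<exists>M. \<forall>n\<ge>M. ds (\<sigma> n) z < e" if "0 < e" for e
    proof -
      obtain M where M: "\<And>n n'. M \<le> n \<Longrightarrow> M \<le> n' \<Longrightarrow> ds (\<sigma> n) (\<sigma> n') < e / 2"
        using Cauchy[OF half_gt_zero[OF \<open>0 < e\<close>]] by blast
      have "\<forall>\<^sub>F x in nhds z. ds x z < e / 2"
        using finsler_dist_nearby[of "e / 2" z] \<open>0 < e\<close>
        by (auto simp: sym_dist_def elim!: eventually_mono)
      moreover have "\<forall>\<^sub>F x in filtermap \<sigma> sequentially. \<exists>n\<ge>M. x = \<sigma> n"
        unfolding eventually_filtermap eventually_sequentially by blast
      \<comment> \<open>Every neighbourhood of \<open>z\<close> meets every tail, which yields one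
        late term within \<open>e / 2\<close> of \<open>z\<close>; the Cauchy property brings in the
        others.\<close>
      ultimately have "\<forall>\<^sub>F x in inf (nhds z) (filtermap \<sigma> sequentially). ds x z < e / 2 \<and> (\<exists>n\<ge>M. x = \<sigma> n)"
        unfolding eventually_inf by blast
      then obtain k where k: "M \<le> k" "ds (\<sigma> k) z < e / 2"
        using eventually_happens'[OF z] by blast
      have "ds (\<sigma> n) z < e" if "M \<le> n" for n
        using triangle[of "\<sigma> n" "\<sigma> k" z] M[OF that k(1)] k(2) by simp
      then show ?thesis by blast
    qed
    then show "\<exists>x. limitin mtopology \<sigma> x sequentially"
      unfolding limit_metric_sequentially by auto
  qed
qed

section \<open>Equivalence of the compactness conditions\<close>

lemma Heine_Borel_imp_compact_Int:
  assumes "\<And>x r. 0 < r \<Longrightarrow> compact (closure (sym_ball A F x r))" "0 < r1" "0 < r2"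
  shows "compact (closure (forward_ball A F x r1) \<inter> closure (backward_ball A F y r2))"
proof -
  let ?S = "closure (forward_ball A F x r1) \<inter> closure (backward_ball A F y r2)"
  \<comment> \<open>Through \<open>y\<close>, the distance back from \<open>z\<close> to
    \<open>x\<close> is at most \<open>r2 + d y x\<close>. Half of the total bounds
    \<open>ds x z\<close>, so the full total, being positive, is a strict bound.\<close>
  have "z \<in> sym_ball A F x (r1 + r2 + d y x)" if "z \<in> ?S" for z
  proof -
    have "d x z \<le> r1" "d z y \<le> r2"
      using that closure_forward_ball closure_backward_ball by blast+
    then show ?thesis
      using finsler_dist_triangle[of z x y] finsler_dist_nonneg[of y x] assms(2,3)
      by (simp add: sym_ball_def sym_dist_def)
  qed
  then have "?S \<subseteq> closure (sym_ball A F x (r1 + r2 + d y x))"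
    using closure_subset by blast
  then have "?S = closure (sym_ball A F x (r1 + r2 + d y x)) \<inter> ?S" by blast
  also have "compact \<dots>"
    using assms finsler_dist_nonneg[of y x]
    by (intro compact_Int_closed closed_Int closed_closure) auto
  finally show ?thesis .
qed

lemma compact_Int_imp_Heine_Borel:
  assumes "\<And>x r. 0 < r \<Longrightarrow> compact (closure (forward_ball A F x r) \<inter> closure (backward_ball A F x r))"
    and "0 < r"
  shows "compact (closure (sym_ball A F x r))"
proof -
  let ?S = "closure (forward_ball A F x (3 * r)) \<inter> closure (backward_ball A F x (3 * r))"
  \<comment> \<open>From \<open>ds x z \<le> r\<close> each of the two distances is at most
    \<open>2 * r\<close>; the factor 3 makes the inequality strict.\<close>
  have "z \<in> forward_ball A F x (3 * r) \<inter> backward_ball A F x (3 * r)"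
    if "z \<in> closure (sym_ball A F x r)" for z
  proof -
    have "ds x z \<le> r" using that closure_sym_ball by blast
    then show ?thesis
      using finsler_dist_nonneg[of x z] finsler_dist_nonneg[of z x] \<open>0 < r\<close>
      by (simp add: forward_ball_def backward_ball_def sym_dist_def field_simps)
  qed
  then have "closure (sym_ball A F x r) = ?S \<inter> closure (sym_ball A F x r)"
    using closure_subset by blast
  also have "compact \<dots>"
    by (rule compact_Int_closed[OF assms(1) closed_closure]) (use \<open>0 < r\<close> in simp)
  finally show ?thesis .
qed

end

theorem proposition2p2:
  fixes A :: "('a::t2_space, 'e::{real_normed_vector, heine_borel}) chart set"
    and F :: "'a \<times> ('a, 'e) tangent \<Rightarrow> real"
  assumes "finsler_manifold A F"
  shows "let a = (\<forall>x r. 0 < r \<longrightarrow> compact (closure (sym_ball A F x r)));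
             b = (\<forall>x r. 0 < r \<longrightarrow>
                    compact (closure (forward_ball A F x r) \<inter> closure (backward_ball A F x r)));
             c = (\<forall>x y r1 r2. 0 < r1 \<longrightarrow> 0 < r2 \<longrightarrow>
                    compact (closure (forward_ball A F x r1) \<inter> closure (backward_ball A F y r2)))
         in (a \<longleftrightarrow> b) \<and> (b \<longleftrightarrow> c) \<and>
            (a \<or> b \<or> c \<longrightarrow>
               Metric_space UNIV (sym_dist A F) \<and> Metric_space.mcomplete UNIV (sym_dist A F))"
proof -
  interpret finsler_manifold A F by fact
  define a where "a \<longleftrightarrow> (\<forall>x r. 0 < r \<longrightarrow> compact (closure (sym_ball A F x r)))"
  define b where "b \<longleftrightarrow> (\<forall>x r. 0 < r \<longrightarrow>
    compact (closure (forward_ball A F x r) \<inter> closure (backward_ball A F x r)))"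
  define c where "c \<longleftrightarrow> (\<forall>x y r1 r2. 0 < r1 \<longrightarrow> 0 < r2 \<longrightarrow>
    compact (closure (forward_ball A F x r1) \<inter> closure (backward_ball A F y r2)))"
  \<comment> \<open>The implications form the cycle \<open>a\<close>, \<open>c\<close>,
    \<open>b\<close>, \<open>a\<close>; condition \<open>b\<close> is the case of equal centres and
    radii in \<open>c\<close>.\<close>
  have "a \<Longrightarrow> c" using Heine_Borel_imp_compact_Int by (simp add: a_def c_def)
  moreover have "c \<Longrightarrow> b" by (simp add: b_def c_def)
  moreover have "b \<Longrightarrow> a" using compact_Int_imp_Heine_Borel by (simp add: a_def b_def)
  moreover have "a \<Longrightarrow> Metric_space.mcomplete UNIV (sym_dist A F)"
    using mcomplete_sym_dist by (simp add: a_def)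
  ultimately have "(a \<longleftrightarrow> b) \<and> (b \<longleftrightarrow> c) \<and> (a \<or> b \<or> c \<longrightarrow>
      Metric_space UNIV (sym_dist A F) \<and> Metric_space.mcomplete UNIV (sym_dist A F))"
    using Metric_space_sym_dist by blast
  then show ?thesis unfolding Let_def a_def b_def c_def .
qed

end
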